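(* Assume that $0<b_2<b_1<1$ and let $\omega$ be a $\mathcal P(b_1,b_2)$-distributed random configuration of the six-vertex model in the quadrant, with height function $H(x,y;\omega)$. Then for any $x,y>0$ the following convergence holds in probability: $$\lim_{L\to+\infty}\frac{H(Lx,Ly;\omega)}{L}=\mathcal H(x,y),$$ where $$\mathcal H(x,y)=\begin{cases}\dfrac{\left(\sqrt{y(1-b_1)}-\sqrt{x(1-b_2)}\right)^2}{b_1-b_2}, & \dfrac{1-b_1}{1-b_2}<\dfrac{x}{y}<\dfrac{1-b_2}{1-b_1},\\[2mm] 0,& \dfrac{x}{y}\le\dfrac{1-b_1}{1-b_2},\\[2mm] x-y,&\dfrac{x}{y}\ge\dfrac{1-b_2}{1-b_1}.\end{cases}$$
   Context: Six-vertex configurations in the quadrant. To each vertex of the grid $\mathbb Z_{>0}\times\mathbb Z_{>0}$ (first coordinate horizontal, second vertical) one assigns one of six types, specified by which of the four adjacent edges (west, south, east, north) are bold: $a_1$: none; $a_2$: all four; $b_1$: south and north; $b_2$: west and east; $c_1$: south and east; $c_2$: west and north. The assignment must be consistent (an edge shared by two adjacent vertices is bold for both or for neither), the south edge of every vertex $(x,1)$, $x>0$, is bold, and the west edge of every vertex $(1,y)$, $y>0$, is not bold. $\Omega$ is the set of all such configurations. The measure $\mathcal P(b_1,b_2)$, $0<b_1,b_2<1$, is the probability measure on $\Omega$ obtained by the following sequential sampling: vertices $(x,y)$ are processed in increasing order of $x+y$; when $(x,y)$ is processed it is known whether its west and south edges are bold. If both are bold, the type is $a_2$. If neither is bold, the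 type is $a_1$. If west is bold and south is not, the type is $b_2$ with probability $b_2$ and $c_2$ with probability $1-b_2$. If south is bold and west is not, the type is $b_1$ with probability $b_1$ and $c_1$ with probability $1-b_1$. All random choices are independent. Height function: for real $x,y>0$, $H(x,y;\omega)$ is the number of integers $i$ with $1\le i\le x$ such that the vertex $(i,\lceil y\rceil)$ has a bold south edge (i.e. is of type $a_2$, $b_1$ or $c_1$) in $\omega$. *)

theory Defs
  imports "HOL-Probability.Probability"
begin

section \<open>Six-vertex configurations in the quadrant\<close>

datatype vertex_type = A1 | A2 | B1 | B2 | C1 | C2

fun west_bold :: "vertex_type \<Rightarrow> bool" where
  "west_bold t \<longleftrightarrow> t \<in> {A2, B2, C2}"

fun south_bold :: "vertex_type \<Rightarrow> bool" where
  "south_bold t \<longleftrightarrow> t \<in> {A2, B1, C1}"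

fun east_bold :: "vertex_type \<Rightarrow> bool" where
  "east_bold t \<longleftrightarrow> t \<in> {A2, B2, C1}"

fun north_bold :: "vertex_type \<Rightarrow> bool" where
  "north_bold t \<longleftrightarrow> t \<in> {A2, B1, C2}"

type_synonym config = "nat \<times> nat \<Rightarrow> vertex_type"

definition quadrant :: "(nat \<times> nat) set" where
  "quadrant = {1..} \<times> {1..}"

text \<open>Configurations are functions on all pairs of naturals that take the value
  \<^const>\<open>undefined\<close> outside the quadrant, so that a configuration is determined by its
  restriction to the quadrant.\<close>

definition six_vertex_configs :: "config set" where
  "six_vertex_configs =
    {\<omega> \<in> quadrant \<rightarrow>\<^sub>E UNIV.
       (\<forall>x\<ge>1. \<forall>y\<ge>1. east_bold (\<omega> (x, y)) = west_bold (\<omega> (x + 1, y))) \<and>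
       (\<forall>x\<ge>1. \<forall>y\<ge>1. north_bold (\<omega> (x, y)) = south_bold (\<omega> (x, y + 1))) \<and>
       (\<forall>x\<ge>1. south_bold (\<omega> (x, 1))) \<and>
       (\<forall>y\<ge>1. \<not> west_bold (\<omega> (1, y)))}"

text \<open>The sigma-algebra is the one generated by the types of the individual vertices.\<close>

definition config_space :: "config measure" where
  "config_space =
    restrict_space (\<Pi>\<^sub>M v\<in>quadrant. count_space UNIV) six_vertex_configs"


section \<open>The stochastic six-vertex measure\<close>

text \<open>Every vertex carries two independent coins, independent over all vertices, with success
  probabilities \<open>b1\<close> and \<open>b2\<close>. The first is used only if south is the only bold incoming edge,
  the second only if west is. So each vertex uses at most one coin, and that coin is independent
  of all the vertices with a smaller sum of coordinates.\<close>

fun sample_vertex :: "bool \<Rightarrow> bool \<Rightarrow> bool \<times> bool \<Rightarrow> vertex_type" where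
  "sample_vertex west south (coin1, coin2) =
    (if west \<and> south then A2
     else if \<not> west \<and> \<not> south then A1
     else if west then (if coin2 then B2 else C2)
     else (if coin1 then B1 else C1))"

function sample_at :: "(nat \<times> nat \<Rightarrow> bool \<times> bool) \<Rightarrow> nat \<Rightarrow> nat \<Rightarrow> vertex_type" where
  "sample_at c x y =
    sample_vertex
      (if x \<le> 1 then False else east_bold (sample_at c (x - 1) y))
      (if y \<le> 1 then True else north_bold (sample_at c x (y - 1)))
      (c (x, y))"
  by auto
termination
  by (relation "Wellfounded.measure (\<lambda>(c, x, y). x + y)") auto

declare sample_at.simps [simp del]

definition sample_config :: "(nat \<times> nat \<Rightarrow> bool \<times> bool) \<Rightarrow> config" where
  "sample_config c = (\<lambda>(x, y)\<in>quadrant. sample_at c x y)"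

definition coins :: "real \<Rightarrow> real \<Rightarrow> (nat \<times> nat \<Rightarrow> bool \<times> bool) measure" where
  "coins b1 b2 =
    (\<Pi>\<^sub>M v\<in>quadrant. measure_pmf (pair_pmf (bernoulli_pmf b1) (bernoulli_pmf b2)))"

definition six_vertex_measure :: "real \<Rightarrow> real \<Rightarrow> config measure" where
  "six_vertex_measure b1 b2 = distr (coins b1 b2) config_space sample_config"


section \<open>Height function and limit shape\<close>

definition height_function :: "real \<Rightarrow> real \<Rightarrow> config \<Rightarrow> nat" where
  "height_function x y \<omega> = card {i::nat. 1 \<le> i \<and> real i \<le> x \<and> south_bold (\<omega> (i, nat \<lceil>y\<rceil>))}"

definition limit_height :: "real \<Rightarrow> real \<Rightarrow> real \<Rightarrow> real \<Rightarrow> real" where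
  "limit_height b1 b2 x y =
    (if (1 - b1) / (1 - b2) < x / y \<and> x / y < (1 - b2) / (1 - b1)
       then (sqrt (y * (1 - b1)) - sqrt (x * (1 - b2)))\<^sup>2 / (b1 - b2)
     else if x / y \<le> (1 - b1) / (1 - b2) then 0
     else x - y)"


section \<open>Well-definedness\<close>

lemma sample_vertex_bold:
  "west_bold (sample_vertex w s k) = w" "south_bold (sample_vertex w s k) = s"
  by (cases k; auto)+

lemma sample_config_in_configs: "sample_config c \<in> six_vertex_configs"
proof -
  have w: "west_bold (sample_at c x y) = (if x \<le> 1 then False else east_bold (sample_at c (x - 1) y))"
    and s: "south_bold (sample_at c x y) = (if y \<le> 1 then True else north_bold (sample_at c x (y - 1)))"
    for x y
    by (subst sample_at.simps, simp only: sample_vertex_bold)+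
  show ?thesis
    unfolding six_vertex_configs_def sample_config_def
    by (auto simp: quadrant_def w s simp del: west_bold.simps south_bold.simps
        east_bold.simps north_bold.simps)
qed

lemma space_config_space: "space config_space = six_vertex_configs"
  by (auto simp: config_space_def space_restrict_space space_PiM six_vertex_configs_def)

lemma measurable_sample_at:
  assumes "x \<ge> 1" "y \<ge> 1"
  shows "(\<lambda>c. sample_at c x y) \<in> measurable (coins b1 b2) (count_space UNIV)"
  using assms
proof (induction "x + y" arbitrary: x y rule: less_induct)
  case less
  have c: "(\<lambda>c. c (x, y)) \<in> measurable (coins b1 b2) (count_space UNIV)"
    unfolding coins_def
    by (rule measurable_compose[OF measurable_component_singleton])
       (use less.prems in \<open>auto simp: quadrant_def\<close>)
  have w: "(\<lambda>c. if x \<le> 1 then False else east_bold (sample_at c (x - 1) y))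
      \<in> measurable (coins b1 b2) (count_space UNIV)"
  proof (cases "x \<le> 1")
    case False
    then have "(\<lambda>c. sample_at c (x - 1) y) \<in> measurable (coins b1 b2) (count_space UNIV)"
      using less by (intro less.hyps) auto
    from measurable_compose[OF this, of east_bold "count_space UNIV"] False show ?thesis
      by simp
  qed simp
  have s: "(\<lambda>c. if y \<le> 1 then True else north_bold (sample_at c x (y - 1)))
      \<in> measurable (coins b1 b2) (count_space UNIV)"
  proof (cases "y \<le> 1")
    case False
    then have "(\<lambda>c. sample_at c x (y - 1)) \<in> measurable (coins b1 b2) (count_space UNIV)"
      using less by (intro less.hyps) auto
    from measurable_compose[OF this, of north_bold "count_space UNIV"] False show ?thesis
      by simp
  qed simp
  show ?case
    apply (subst sample_at.simps)
    apply (rule measurable_compose_countable[OF _ w])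
    apply (rule measurable_compose_countable[OF _ s])
    apply (rule measurable_compose[OF c])
    apply simp
    done
qed

lemma measurable_sample_config: "sample_config \<in> measurable (coins b1 b2) config_space"
  unfolding config_space_def
proof (rule measurable_restrict_space2)
  show "sample_config \<in> space (coins b1 b2) \<rightarrow> six_vertex_configs"
    using sample_config_in_configs by auto
  show "sample_config \<in> measurable (coins b1 b2) (\<Pi>\<^sub>M v\<in>quadrant. count_space UNIV)"
    unfolding sample_config_def
    by (rule measurable_restrict)
       (auto simp: quadrant_def split_beta intro!: measurable_sample_at)
qed

lemma prob_space_six_vertex_measure: "prob_space (six_vertex_measure b1 b2)"
proof -
  have "prob_space (coins b1 b2)"
    unfolding coins_def by (intro prob_space_PiM measure_pmf.prob_space_axioms)
  then show ?thesis
    unfolding six_vertex_measure_def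
    by (rule prob_space.prob_space_distr) (rule measurable_sample_config)
qed

lemma space_six_vertex_measure: "space (six_vertex_measure b1 b2) = six_vertex_configs"
  by (simp add: six_vertex_measure_def space_config_space)

lemma measurable_height_function:
  assumes "y > 0"
  shows "height_function x y \<in> measurable (six_vertex_measure b1 b2) (count_space UNIV)"
proof -
  let ?I = "{i::nat. 1 \<le> i \<and> real i \<le> x}"
  have "?I \<subseteq> {..nat \<lfloor>x\<rfloor>}" by (auto simp: le_nat_iff le_floor_iff)
  then have fin: "finite ?I" by (rule finite_subset) simp
  have v: "(\<lambda>\<omega>. \<omega> (i, nat \<lceil>y\<rceil>)) \<in> measurable (six_vertex_measure b1 b2) (count_space UNIV)"
    if "i \<ge> 1" for i
  proof -
    have "1 \<le> nat \<lceil>y\<rceil>" using assms by linarith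
    then have "(i, nat \<lceil>y\<rceil>) \<in> quadrant" using that by (auto simp: quadrant_def)
    then have "(\<lambda>\<omega>. \<omega> (i, nat \<lceil>y\<rceil>)) \<in> measurable config_space (count_space UNIV)"
      unfolding config_space_def
      by (intro measurable_restrict_space1 measurable_component_singleton)
    then show ?thesis by (simp add: six_vertex_measure_def)
  qed
  have "height_function x y = (\<lambda>\<omega>. \<Sum>i\<in>?I. of_bool (south_bold (\<omega> (i, nat \<lceil>y\<rceil>))))"
  proof
    fix \<omega>
    have "{i::nat. 1 \<le> i \<and> real i \<le> x \<and> south_bold (\<omega> (i, nat \<lceil>y\<rceil>))}
        = ?I \<inter> {i. south_bold (\<omega> (i, nat \<lceil>y\<rceil>))}" by auto
    then show "height_function x y \<omega> = (\<Sum>i\<in>?I. of_bool (south_bold (\<omega> (i, nat \<lceil>y\<rceil>))))"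
      unfolding height_function_def using fin by (simp only: sum_of_bool_eq of_nat_id)
  qed
  moreover have "(\<lambda>\<omega>. \<Sum>i\<in>?I. of_bool (south_bold (\<omega> (i, nat \<lceil>y\<rceil>))) :: nat)
      \<in> measurable (six_vertex_measure b1 b2) (count_space UNIV)"
  proof (rule measurable_sum_nat)
    fix i assume "i \<in> ?I"
    then have "i \<ge> 1" by simp
    from measurable_compose[OF v[OF this], of "\<lambda>t. of_bool (south_bold t) :: nat"]
    show "(\<lambda>\<omega>. of_bool (south_bold (\<omega> (i, nat \<lceil>y\<rceil>))) :: nat)
        \<in> measurable (six_vertex_measure b1 b2) (count_space UNIV)" by simp
  qed
  ultimately show ?thesis by simp
qed

end

theory Submission
  imports Defs
begin

text \<open>Write \<open>\<phi>(t) = t (1 - b1) / ((1 - b2) - (b1 - b2) t)\<close>. If the edges entering the quadrant are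
  independent and bold with probability \<open>t\<close> at the bottom and \<open>\<phi>(t)\<close> on the left, then every row
  and every column of edges again consists of independent edges with these probabilities. The limit
  shape is the supremum of \<open>t x - \<phi>(t) y\<close> over \<open>t\<close> in \<open>[0, 1]\<close>.

  Lower bound: the dynamics driven by the same coins is monotone in the entering edges, so the height
  dominates the number of bold bottom edges minus the number of bold edges leaving to the right in the
  stationary process.

  Upper bound: discrepancies between the configuration and the stationary process are only ever
  destroyed, and two opposite ones close to each other are destroyed with probability bounded below.
  Only linearly many enter an \<open>N\<close> by \<open>N\<close> box, so on all but few cells of fixed size there
  are no opposite discrepancies between its bottom and its left side. If the bottom of such a cell is
  denser than \<open>t\<close>, its left side is therefore at least as dense as \<open>\<phi>(t)\<close>. Hence in the mean
  the height grows along a ray at most at the rate of the limit shape. Together with the lower bound in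
  probability this gives convergence.\<close>

section \<open>Edges of a configuration\<close>

text \<open>Success of the relevant coin means going straight, so a path from the west turns north
  when the second coin fails. Edges are tracked instead of vertex types because conservation and
  monotonicity are statements about edges.\<close>

definition north_out :: "bool \<Rightarrow> bool \<Rightarrow> bool \<times> bool \<Rightarrow> bool" where
  "north_out w s k = (if w = s then w else if w then \<not> snd k else fst k)"

definition east_out :: "bool \<Rightarrow> bool \<Rightarrow> bool \<times> bool \<Rightarrow> bool" where
  "east_out w s k = (if w = s then w else if w then snd k else \<not> fst k)"

text \<open>\<open>hor l b c x y\<close> is the edge from \<open>(x, y)\<close> to \<open>(x + 1, y)\<close> and \<open>ver l b c x y\<close> the edge from
  \<open>(x, y)\<close> to \<open>(x, y + 1)\<close>, for entrance data \<open>l\<close> on the left and \<open>b\<close> at the bottom.\<close>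

fun hor ver :: "(nat \<Rightarrow> bool) \<Rightarrow> (nat \<Rightarrow> bool) \<Rightarrow> (nat \<times> nat \<Rightarrow> bool \<times> bool) \<Rightarrow> nat \<Rightarrow> nat \<Rightarrow> bool" where
  "hor l b c 0 y = l y"
| "hor l b c (Suc x) 0 = False"
| "hor l b c (Suc x) (Suc y) =
     east_out (hor l b c x (Suc y)) (ver l b c (Suc x) y) (c (Suc x, Suc y))"
| "ver l b c x 0 = b x"
| "ver l b c 0 (Suc y) = False"
| "ver l b c (Suc x) (Suc y) =
     north_out (hor l b c x (Suc y)) (ver l b c (Suc x) y) (c (Suc x, Suc y))"

abbreviation ind :: "bool \<Rightarrow> real" where "ind \<equiv> of_bool"

section \<open>Conservation, monotonicity and contraction of the vertex rule\<close>

lemma out_conserve: "ind (north_out w s k) + ind (east_out w s k) = ind w + ind s"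
  by (auto simp: north_out_def east_out_def)

text \<open>Two distinct comparable inputs include the empty or the full one, whose outputs are
  minimal or maximal. Hence a common coin keeps two ordered evolutions ordered.\<close>

lemma out_mono:
  assumes "w \<le> w'" "s \<le> s'"
  shows "north_out w s k \<le> north_out w' s' k" "east_out w s k \<le> east_out w' s' k"
  using assms by (auto simp: north_out_def east_out_def)

text \<open>For comparable inputs \<open>out_mono\<close> and \<open>out_conserve\<close> give
  equality. The inputs "west only" and "south only" are at distance 2; their outputs agree if the
  two coins differ and are opposite otherwise.\<close>

lemma out_contract:
  "\<bar>ind (north_out w s k) - ind (north_out w' s' k)\<bar> + \<bar>ind (east_out w s k) - ind (east_out w' s' k)\<bar>
    \<le> \<bar>ind w - ind w'\<bar> + \<bar>ind s - ind s'\<bar>"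
  by (cases w; cases s; cases w'; cases s') (auto simp: north_out_def east_out_def)

lemma edge_mono:
  assumes "\<And>j. l j \<le> l' j" "\<And>i. b i \<le> b' i"
  shows "hor l b c x y \<le> hor l' b' c x y" "ver l b c x y \<le> ver l' b' c x y"
proof -
  have "hor l b c x y \<le> hor l' b' c x y \<and> ver l b c x y \<le> ver l' b' c x y"
  proof (induction "x + y" arbitrary: x y rule: less_induct)
    case less
    show ?case
    proof (cases x; cases y)
      fix x' y' assume [simp]: "x = Suc x'" "y = Suc y'"
      have "hor l b c x' y \<le> hor l' b' c x' y" "ver l b c x y' \<le> ver l' b' c x y'"
        using less by simp_all
      then show ?thesis using out_mono by simp
    qed (use assms in simp_all)
  qed
  then show "hor l b c x y \<le> hor l' b' c x y" "ver l b c x y \<le> ver l' b' c x y" by auto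
qed

text \<open>Locality of the recursion. It is the source of the independence of edges from later
  coins and of the passage from the infinite coin field to a finite box.\<close>

lemma edge_cong:
  assumes "\<And>j. j \<le> y \<Longrightarrow> l j = l' j" "\<And>i. i \<le> x \<Longrightarrow> b i = b' i"
    and "\<And>i j. 1 \<le> i \<Longrightarrow> i \<le> x \<Longrightarrow> 1 \<le> j \<Longrightarrow> j \<le> y \<Longrightarrow> c (i, j) = c' (i, j)"
  shows "hor l b c x y = hor l' b' c' x y \<and> ver l b c x y = ver l' b' c' x y"
  using assms
proof (induction "x + y" arbitrary: x y rule: less_induct)
  case less
  show ?case
  proof (cases x; cases y)
    fix x' y' assume [simp]: "x = Suc x'" "y = Suc y'"
    have "hor l b c x' y = hor l' b' c' x' y" "ver l b c x y' = ver l' b' c' x y'"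
      using less by simp_all
    then show ?thesis using less.prems by simp
  qed (use less.prems in simp_all)
qed

text \<open>Discrete divergence theorem: every interior edge occurs once with each sign, so only the
  boundary of the box survives.\<close>

lemma box_telescope:
  fixes f g :: "nat \<Rightarrow> nat \<Rightarrow> real"
  shows "(\<Sum>x<N. \<Sum>y<M. f x (Suc y) + g (Suc x) y - (g (Suc x) (Suc y) + f (Suc x) (Suc y)))
    = (\<Sum>y<M. f 0 (Suc y) - f N (Suc y)) + (\<Sum>x<N. g (Suc x) 0 - g (Suc x) M)"
proof -
  have "(\<Sum>x<N. \<Sum>y<M. f x (Suc y) + g (Suc x) y - (g (Suc x) (Suc y) + f (Suc x) (Suc y)))
    = (\<Sum>x<N. (\<Sum>y<M. f x (Suc y) - f (Suc x) (Suc y)) + (\<Sum>y<M. g (Suc x) y - g (Suc x) (Suc y)))"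
    by (simp add: sum.distrib sum_subtractf algebra_simps)
  also have "\<dots> = (\<Sum>x<N. \<Sum>y<M. f x (Suc y) - f (Suc x) (Suc y)) + (\<Sum>x<N. g (Suc x) 0 - g (Suc x) M)"
    by (simp add: sum_lessThan_telescope' sum.distrib)
  also have "(\<Sum>x<N. \<Sum>y<M. f x (Suc y) - f (Suc x) (Suc y)) = (\<Sum>y<M. f 0 (Suc y) - f N (Suc y))"
    by (subst sum.swap, rule sum.cong[OF refl]) (rule sum_lessThan_telescope')
  finally show ?thesis .
qed

lemma box_conserve:
  "(\<Sum>x<N. ind (ver l b c (Suc x) M)) + (\<Sum>y<M. ind (hor l b c N (Suc y)))
    = (\<Sum>x<N. ind (b (Suc x))) + (\<Sum>y<M. ind (l (Suc y)))"
proof -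
  have "(\<Sum>x<N. \<Sum>y<M. ind (hor l b c x (Suc y)) + ind (ver l b c (Suc x) y)
      - (ind (ver l b c (Suc x) (Suc y)) + ind (hor l b c (Suc x) (Suc y)))) = 0"
    by (simp add: out_conserve)
  with box_telescope[of "\<lambda>x y. ind (hor l b c x y)" "\<lambda>x y. ind (ver l b c x y)" M N]
  show ?thesis by (simp add: sum_subtractf)
qed


text \<open>The number of discrepancies between two evolutions driven by the same coins that disappear
  at the vertex \<open>(x + 1, y + 1)\<close>.\<close>

definition lost :: "(nat \<Rightarrow> bool) \<Rightarrow> (nat \<Rightarrow> bool) \<Rightarrow> (nat \<Rightarrow> bool) \<Rightarrow> (nat \<Rightarrow> bool) \<Rightarrow>
    (nat \<times> nat \<Rightarrow> bool \<times> bool) \<Rightarrow> nat \<Rightarrow> nat \<Rightarrow> real" where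
  "lost l b l' b' c x y =
     \<bar>ind (hor l b c x (Suc y)) - ind (hor l' b' c x (Suc y))\<bar>
     + \<bar>ind (ver l b c (Suc x) y) - ind (ver l' b' c (Suc x) y)\<bar>
     - (\<bar>ind (ver l b c (Suc x) (Suc y)) - ind (ver l' b' c (Suc x) (Suc y))\<bar>
     + \<bar>ind (hor l b c (Suc x) (Suc y)) - ind (hor l' b' c (Suc x) (Suc y))\<bar>)"

lemma lost_nonneg: "lost l b l' b' c x y \<ge> 0"
  using out_contract by (simp add: lost_def)

lemma abs_ind_diff_le: "\<bar>ind p - ind q\<bar> \<le> 1"
  by auto

text \<open>Losses telescope to the discrepancies that enter minus those that leave, and a boundary
  edge carries at most one.\<close>

lemma sum_lost_le: "(\<Sum>x<N. \<Sum>y<M. lost l b l' b' c x y) \<le> real N + real M"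
proof -
  let ?f = "\<lambda>x y. \<bar>ind (hor l b c x y) - ind (hor l' b' c x y)\<bar>"
  let ?g = "\<lambda>x y. \<bar>ind (ver l b c x y) - ind (ver l' b' c x y)\<bar>"
  have "(\<Sum>x<N. \<Sum>y<M. lost l b l' b' c x y)
      = (\<Sum>y<M. ?f 0 (Suc y) - ?f N (Suc y)) + (\<Sum>x<N. ?g (Suc x) 0 - ?g (Suc x) M)"
    unfolding lost_def by (rule box_telescope)
  also have "\<dots> \<le> (\<Sum>y<M. 1) + (\<Sum>x<N. 1)"
    by (intro add_mono sum_mono) (use abs_ind_diff_le in \<open>smt (verit)\<close>)+
  finally show ?thesis by simp
qed

section \<open>Annihilating two opposite discrepancies by prescribed coins\<close>

lemma steer:
  assumes "\<And>i j. i \<le> p \<Longrightarrow> j \<le> q \<Longrightarrow> (i, j) \<noteq> (p, q) \<Longrightarrow> c (X + Suc i, Y + Suc j) = (True, True)"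
  shows "hor l b c (X + p) (Y + Suc q) = hor l b c X (Y + Suc q)"
    and "ver l b c (X + Suc p) (Y + q) = ver l b c (X + Suc p) Y"
proof -
  have "i \<le> p \<Longrightarrow> hor l b c (X + i) (Y + Suc q) = hor l b c X (Y + Suc q)" for i
  proof (induction i)
    case (Suc i)
    then show ?case using assms[of i q] by (simp add: east_out_def)
  qed simp
  then show "hor l b c (X + p) (Y + Suc q) = hor l b c X (Y + Suc q)" by blast
  have "j \<le> q \<Longrightarrow> ver l b c (X + Suc p) (Y + j) = ver l b c (X + Suc p) Y" for j
  proof (induction j)
    case (Suc j)
    then show ?case using assms[of p j] by (simp add: north_out_def)
  qed simp
  then show "ver l b c (X + Suc p) (Y + q) = ver l b c (X + Suc p) Y" by blast
qed

text \<open>Each evolution brings a single path to the vertex, one from the south and the other from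
  the west. The coins \<open>(True, False)\<close> send both north, so both discrepancies
  disappear.\<close>

lemma steered_lost:
  assumes "\<And>i j. i \<le> p \<Longrightarrow> j \<le> q \<Longrightarrow> (i, j) \<noteq> (p, q) \<Longrightarrow> c (X + Suc i, Y + Suc j) = (True, True)"
    and "c (X + Suc p, Y + Suc q) = (True, False)"
    and "ver l b c (X + Suc p) Y" "\<not> ver l' b' c (X + Suc p) Y"
    and "\<not> hor l b c X (Y + Suc q)" "hor l' b' c X (Y + Suc q)"
  shows "lost l b l' b' c (X + p) (Y + q) = 2"
proof -
  note s = steer[of p q c X Y, OF assms(1)]
  show ?thesis using s(1)[of l b] s(1)[of l' b'] s(2)[of l b] s(2)[of l' b'] assms(2-)
    by (simp add: lost_def north_out_def east_out_def)
qed

text \<open>Step data, nothing on the left and everything at the bottom, reproduce the sampler. The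
  incoming edges of a vertex are outgoing edges of its neighbours, hence the shifts by one.\<close>

lemma south_west_sample_at:
  assumes "x \<ge> 1" "y \<ge> 1"
  shows "west_bold (sample_at c x y) = hor (\<lambda>_. False) (\<lambda>_. True) c (x - 1) y \<and>
    south_bold (sample_at c x y) = ver (\<lambda>_. False) (\<lambda>_. True) c x (y - 1)"
  using assms
proof (induction "x + y" arbitrary: x y rule: less_induct)
  case less
  have e: "east_bold (sample_vertex w s k) = east_out w s k" and
    n: "north_bold (sample_vertex w s k) = north_out w s k" for w s k
    by (cases k; auto simp: north_out_def east_out_def)+
  define W where "W x y = (if x \<le> 1 then False else east_bold (sample_at c (x - 1) y))" for x y
  define S where "S x y = (if y \<le> 1 then True else north_bold (sample_at c x (y - 1)))" for x y
  have sa: "sample_at c x y = sample_vertex (W x y) (S x y) (c (x, y))" for x y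
    unfolding W_def S_def by (subst sample_at.simps) simp
  have w: "west_bold (sample_at c x y) = W x y" and s: "south_bold (sample_at c x y) = S x y" for x y
    by (subst sa, simp only: sample_vertex_bold)+
  have W': "W x y = hor (\<lambda>_. False) (\<lambda>_. True) c (x - 1) y"
  proof (cases "x \<le> 1")
    case True
    then show ?thesis by (simp add: W_def)
  next
    case False
    then obtain x' where x: "x = Suc (Suc x')" by (metis Suc_le_D not_less_eq_eq One_nat_def)
    obtain y' where y: "y = Suc y'" using less.prems by (cases y) auto
    have "W x y = east_out (W (x - 1) y) (S (x - 1) y) (c (x - 1, y))"
      unfolding W_def[of x y] using False by (simp add: sa e del: east_bold.simps)
    then show ?thesis using less.hyps[of "x - 1" y, unfolded w s] less.prems x y by simp
  qed
  have S': "S x y = ver (\<lambda>_. False) (\<lambda>_. True) c x (y - 1)"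
  proof (cases "y \<le> 1")
    case True
    then show ?thesis by (simp add: S_def)
  next
    case False
    then obtain y' where y: "y = Suc (Suc y')" by (metis Suc_le_D not_less_eq_eq One_nat_def)
    obtain x' where x: "x = Suc x'" using less.prems by (cases x) auto
    have "S x y = north_out (W x (y - 1)) (S x (y - 1)) (c (x, y - 1))"
      unfolding S_def[of x y] using False by (simp add: sa n del: north_bold.simps)
    then show ?thesis using less.hyps[of x "y - 1", unfolded w s] less.prems x y by simp
  qed
  show ?case using w s W' S' by simp
qed


section \<open>The stationary process in a box\<close>

text \<open>Resampling the site \<open>z\<close> does not affect \<open>G\<close>, so this site can
  be drawn first and integrated separately.\<close>

lemma expectation_Pi_pmf_site:
  fixes G :: "('a \<Rightarrow> 'b) \<Rightarrow> real" and k :: "'b \<Rightarrow> real"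
  assumes "finite A" "z \<in> A" and fin: "\<And>x. finite (set_pmf (p x))"
    and G: "\<And>c u. G (c(z := u)) = G c"
  shows "measure_pmf.expectation (Pi_pmf A d p) (\<lambda>c. G c * k (c z))
    = measure_pmf.expectation (Pi_pmf A d p) G * measure_pmf.expectation (p z) k"
proof -
  let ?B = "Pi_pmf (A - {z}) d p"
  have P: "Pi_pmf A d p = do {u \<leftarrow> p z; c \<leftarrow> ?B; return_pmf (c(z := u))}"
    using Pi_pmf_insert'[of "A - {z}" z d p] assms by (simp add: insert_absorb)
  have finB: "finite (set_pmf ?B)"
    by (rule finite_subset[OF set_Pi_pmf_subset']) (use assms in auto)
  have E: "measure_pmf.expectation (Pi_pmf A d p) (\<lambda>c. G c * k (c z))
      = measure_pmf.expectation ?B G * measure_pmf.expectation (p z) k" for k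
  proof -
    have "measure_pmf.expectation (Pi_pmf A d p) (\<lambda>c. G c * k (c z))
      = (\<Sum>u\<in>set_pmf (p z). pmf (p z) u *\<^sub>R
          measure_pmf.expectation (?B \<bind> (\<lambda>c. return_pmf (c(z := u)))) (\<lambda>c. G c * k (c z)))"
      unfolding P by (rule pmf_expectation_bind) (use fin finB in auto)
    also have "\<dots> = (\<Sum>u\<in>set_pmf (p z). pmf (p z) u * (measure_pmf.expectation ?B G * k u))"
      by (simp add: map_pmf_def[symmetric] G)
    also have "\<dots> = measure_pmf.expectation ?B G * (\<Sum>u\<in>set_pmf (p z). k u * pmf (p z) u)"
      by (simp add: sum_distrib_left algebra_simps)
    also have "(\<Sum>u\<in>set_pmf (p z). k u * pmf (p z) u) = measure_pmf.expectation (p z) k"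
      by (rule integral_measure_pmf_real[symmetric]) (use fin in auto)
    finally show ?thesis .
  qed
  \<comment> \<open>The case of constant \<open>k\<close> identifies the expectation of
    \<open>G\<close> over the remaining sites with that over all sites.\<close>
  show ?thesis using E[of k] E[of "\<lambda>_. 1"] by simp
qed

definition site_pmf :: "real \<Rightarrow> real \<Rightarrow> real \<Rightarrow> real \<Rightarrow> nat \<times> nat \<Rightarrow> (bool \<times> bool) pmf" where
  "site_pmf b1 b2 s w v =
     pair_pmf (bernoulli_pmf (if snd v = 0 then s else if fst v = 0 then w else b1)) (bernoulli_pmf b2)"

text \<open>The outputs are affine in the coins, so expectations factor when the coins are
  independent of the inputs. The third identity holds because both outgoing edges are bold exactly
  when both incoming ones are.\<close>

lemma ind_out:
  "ind (north_out w s k) = ind w + ind (fst k) * ind s - ind (snd k) * ind w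
      + (ind (snd k) - ind (fst k)) * (ind w * ind s)"
  "ind (east_out w s k) = ind s - ind (fst k) * ind s + ind (snd k) * ind w
      - (ind (snd k) - ind (fst k)) * (ind w * ind s)"
  "ind (north_out w s k) * ind (east_out w s k) = ind w * ind s"
  by (cases w; cases s; simp add: north_out_def east_out_def)+

text \<open>The coins at the sites \<open>(0, y)\<close> and \<open>(x, 0)\<close> encode the entrance data on the axes.\<close>

locale stationary_box =
  fixes b1 b2 s w :: real and N M :: nat
  assumes b1: "0 < b1" "b1 < 1" and b2: "0 < b2" "b2 < 1"
    and s: "0 \<le> s" "s \<le> 1" and w: "0 \<le> w" "w \<le> 1"
    and balance: "s * (1 - w) * (1 - b1) = w * (1 - s) * (1 - b2)"
begin

abbreviation p where "p \<equiv> site_pmf b1 b2 s w"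

definition P where "P = Pi_pmf ({..N} \<times> {..M}) undefined p"

abbreviation E :: "((nat \<times> nat \<Rightarrow> bool \<times> bool) \<Rightarrow> real) \<Rightarrow> real" where
  "E F \<equiv> measure_pmf.expectation P F"

abbreviation Pr :: "((nat \<times> nat \<Rightarrow> bool \<times> bool) \<Rightarrow> bool) \<Rightarrow> real" where
  "Pr A \<equiv> measure_pmf.prob P {c. A c}"

definition h where "h x y c = hor (\<lambda>j. fst (c (0, j))) (\<lambda>i. fst (c (i, 0))) c x y"
definition v where "v x y c = ver (\<lambda>j. fst (c (0, j))) (\<lambda>i. fst (c (i, 0))) c x y"

section \<open>Moments of the edges of the stationary process\<close>

lemma finite_set_P: "finite (set_pmf P)"
  unfolding P_def by (rule finite_subset[OF set_Pi_pmf_subset']) auto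

lemma integrable_P [simp]: "integrable P (F :: _ \<Rightarrow> real)"
  by (rule integrable_measure_pmf_finite[OF finite_set_P])

lemma E_site:
  assumes "fst z \<le> N" "snd z \<le> M" "\<And>c u. G (c(z := u)) = G c"
  shows "E (\<lambda>c. G c * k (c z)) = E G * measure_pmf.expectation (p z) k"
  unfolding P_def
  by (rule expectation_Pi_pmf_site) (use assms in \<open>auto simp: mem_Times_iff\<close>)

lemma h_indep: "x < fst z \<or> y < snd z \<Longrightarrow> h x y (c(z := u)) = h x y c"
  unfolding h_def by (cases z) (rule conjunct1[OF edge_cong]; auto)

lemma v_indep: "x < fst z \<or> y < snd z \<Longrightarrow> v x y (c(z := u)) = v x y c"
  unfolding v_def by (cases z) (rule conjunct2[OF edge_cong]; auto)

lemma h_0: "h 0 y c = fst (c (0, y))" and v_0: "v x 0 c = fst (c (x, 0))"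
  by (auto simp: h_def v_def)

lemma h_Suc: "h (Suc x) (Suc y) c = east_out (h x (Suc y) c) (v (Suc x) y c) (c (Suc x, Suc y))"
  and v_Suc: "v (Suc x) (Suc y) c = north_out (h x (Suc y) c) (v (Suc x) y c) (c (Suc x, Suc y))"
  by (auto simp: h_def v_def)

lemma expectation_bernoulli: "0 \<le> q \<Longrightarrow> q \<le> 1 \<Longrightarrow>
    measure_pmf.expectation (bernoulli_pmf q) (g :: bool \<Rightarrow> real) = g True * q + g False * (1 - q)"
  by (subst integral_measure_pmf_real[where A = UNIV]) (auto simp: UNIV_bool)

lemma E_fst: "measure_pmf.expectation (pair_pmf (bernoulli_pmf q) r) (\<lambda>k. ind (fst k)) = q"
  if "0 \<le> q" "q \<le> 1"
proof -
  have "measure_pmf.expectation (pair_pmf (bernoulli_pmf q) r) (\<lambda>k. ind (fst k))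
    = measure_pmf.expectation (map_pmf fst (pair_pmf (bernoulli_pmf q) r)) ind" by simp
  then show ?thesis using that by (simp only: map_fst_pair_pmf expectation_bernoulli) simp
qed

lemma E_snd: "measure_pmf.expectation (pair_pmf r (bernoulli_pmf q)) (\<lambda>k. ind (snd k)) = q"
  if "0 \<le> q" "q \<le> 1"
proof -
  have "measure_pmf.expectation (pair_pmf r (bernoulli_pmf q)) (\<lambda>k. ind (snd k))
    = measure_pmf.expectation (map_pmf snd (pair_pmf r (bernoulli_pmf q))) ind" by simp
  then show ?thesis using that by (simp only: map_snd_pair_pmf expectation_bernoulli) simp
qed

lemma E_coin:
  assumes "Suc x \<le> N" "Suc y \<le> M" "\<And>c u. G (c((Suc x, Suc y) := u)) = G c"
  shows "E (\<lambda>c. G c * ind (fst (c (Suc x, Suc y)))) = E G * b1"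
    and "E (\<lambda>c. G c * ind (snd (c (Suc x, Suc y)))) = E G * b2"
  using E_site[of "(Suc x, Suc y)" G "\<lambda>k. ind (fst k)"] E_site[of "(Suc x, Suc y)" G "\<lambda>k. ind (snd k)"]
    assms b1 b2 by (simp_all add: site_pmf_def E_fst E_snd)

text \<open>For independent inputs the balance condition equates the probability of turning from
  south to east with that of turning from west to north, so a vertex preserves both densities. The
  weight \<open>G\<close> stands for the remaining edges of the staircase in
  \<open>burke\<close>.\<close>

lemma E_out:
  assumes "Suc x \<le> N" "Suc y \<le> M" and G: "\<And>c u. G (c((Suc x, Suc y) := u)) = G c"
    and W: "E (\<lambda>c. G c * ind (h x (Suc y) c)) = g * w"
    and S: "E (\<lambda>c. G c * ind (v (Suc x) y c)) = g * s"
    and WS: "E (\<lambda>c. G c * (ind (h x (Suc y) c) * ind (v (Suc x) y c))) = g * (w * s)"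
  shows "E (\<lambda>c. G c * ind (v (Suc x) (Suc y) c)) = g * s"
    and "E (\<lambda>c. G c * ind (h (Suc x) (Suc y) c)) = g * w"
proof -
  let ?h = "\<lambda>c. ind (h x (Suc y) c)" and ?v = "\<lambda>c. ind (v (Suc x) y c)"
  let ?c1 = "\<lambda>c. ind (fst (c (Suc x, Suc y)))" and ?c2 = "\<lambda>c. ind (snd (c (Suc x, Suc y)))"
  have c: "E (\<lambda>c. G c * ?h c * ?c2 c) = g * w * b2" "E (\<lambda>c. G c * ?v c * ?c1 c) = g * s * b1"
    "E (\<lambda>c. G c * (?h c * ?v c) * ?c1 c) = g * (w * s) * b1"
    "E (\<lambda>c. G c * (?h c * ?v c) * ?c2 c) = g * (w * s) * b2"
    by (subst E_coin; simp add: assms h_indep v_indep)+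
  have "E (\<lambda>c. G c * ind (v (Suc x) (Suc y) c)) = E (\<lambda>c. G c * ?h c + G c * ?v c * ?c1 c
      - G c * ?h c * ?c2 c + G c * (?h c * ?v c) * ?c2 c - G c * (?h c * ?v c) * ?c1 c)"
    unfolding v_Suc ind_out by (simp add: algebra_simps)
  also have "\<dots> = g * w + g * s * b1 - g * w * b2 + g * (w * s) * b2 - g * (w * s) * b1"
    by (simp only: Bochner_Integration.integral_add Bochner_Integration.integral_diff integrable_P c W)
  also have "\<dots> = g * s + g * (w * (1 - s) * (1 - b2) - s * (1 - w) * (1 - b1))"
    by algebra
  finally show "E (\<lambda>c. G c * ind (v (Suc x) (Suc y) c)) = g * s"
    using balance by simp
  have "E (\<lambda>c. G c * ind (h (Suc x) (Suc y) c)) = E (\<lambda>c. G c * ?v c - G c * ?v c * ?c1 c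
      + G c * ?h c * ?c2 c - G c * (?h c * ?v c) * ?c2 c + G c * (?h c * ?v c) * ?c1 c)"
    unfolding h_Suc ind_out by (simp add: algebra_simps)
  also have "\<dots> = g * s - g * s * b1 + g * w * b2 - g * (w * s) * b2 + g * (w * s) * b1"
    by (simp only: Bochner_Integration.integral_add Bochner_Integration.integral_diff integrable_P c S)
  also have "\<dots> = g * w + g * (s * (1 - w) * (1 - b1) - w * (1 - s) * (1 - b2))"
    by algebra
  finally show "E (\<lambda>c. G c * ind (h (Suc x) (Suc y) c)) = g * w"
    using balance by simp
qed

text \<open>An analogue of Burke's theorem: product moments over arbitrary subsets encode
  independence of Bernoulli edges on the top and right sides of a rectangle. A staircase of edges is
  pushed through one vertex at a time by \<open>E_out\<close>.\<close>

lemma burke: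
  assumes "X \<le> N" "Y \<le> M" "finite A" "A \<subseteq> {1..X}" "finite B" "B \<subseteq> {1..Y}"
  shows "E (\<lambda>c. (\<Prod>i\<in>A. ind (v i Y c)) * (\<Prod>j\<in>B. ind (h X j c))) = s ^ card A * w ^ card B"
  using assms(2-)
proof (induction Y arbitrary: A B)
  case 0
  from 0(2,3) have "E (\<lambda>c. \<Prod>i\<in>A. ind (v i 0 c)) = s ^ card A"
  proof (induction A rule: finite_induct)
    case (insert a A)
    have "E (\<lambda>c. (\<Prod>i\<in>A. ind (v i 0 c)) * ind (fst (c (a, 0)))) = s ^ card A * s"
    proof (subst E_site)
      show "(\<Prod>i\<in>A. ind (v i 0 (c((a, 0) := u)))) = (\<Prod>i\<in>A. ind (v i 0 c))" for c u
        using insert by (intro prod.cong) (auto simp: v_0)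
    qed (use insert assms(1) s in \<open>auto simp: site_pmf_def E_fst\<close>)
    then show ?case using insert by (simp add: v_0 mult.commute)
  qed simp
  then show ?case using 0 by simp
next
  case (Suc Y)
  \<comment> \<open>The staircase takes the vertical edges above row \<open>Suc Y\<close> in the
    columns up to \<open>n\<close> and those above row \<open>Y\<close> afterwards;
    \<open>hh\<close> is the horizontal edge at the step between them. The flag \<open>t\<close>
    decides whether this edge enters the moment.\<close>
  define vv where "vv n i c = ind (if i \<le> n then v i (Suc Y) c else v i Y c)" for n i c
  define hh where "hh n t c = (if t then ind (h n (Suc Y) c) else 1)" for n t c
  have row: "E (\<lambda>c. (\<Prod>i\<in>A. vv n i c) * (\<Prod>j\<in>B. ind (h X j c)) * hh n t c)
      = s ^ card A * w ^ card B * w ^ of_bool t"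
    if "n \<le> X" "A \<subseteq> {1..X}" "B \<subseteq> {1..Y}" for n A B t
    using that
  proof (induction n arbitrary: A B t)
    case 0
    have fin: "finite A" "finite B" using 0 finite_subset by blast+
    have vv0: "(\<Prod>i\<in>A. vv 0 i c) = (\<Prod>i\<in>A. ind (v i Y c))" for c
      by (rule prod.cong) (use 0 in \<open>auto simp: vv_def\<close>)
    have base: "E (\<lambda>c. (\<Prod>i\<in>A. ind (v i Y c)) * (\<Prod>j\<in>B. ind (h X j c))) = s ^ card A * w ^ card B"
      by (rule Suc.IH) (use 0 Suc.prems fin in auto)
    show ?case
    proof (cases t)
      case True
      have "E (\<lambda>c. (\<Prod>i\<in>A. ind (v i Y c)) * (\<Prod>j\<in>B. ind (h X j c)) * ind (fst (c (0, Suc Y))))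
        = s ^ card A * w ^ card B * w"
      proof (subst E_site)
        show "(\<Prod>i\<in>A. ind (v i Y (c((0, Suc Y) := u)))) * (\<Prod>j\<in>B. ind (h X j (c((0, Suc Y) := u))))
          = (\<Prod>i\<in>A. ind (v i Y c)) * (\<Prod>j\<in>B. ind (h X j c))" for c u
          using 0 by (intro arg_cong2[where f = "(*)"] prod.cong) (auto simp: v_indep h_indep)
      qed (use Suc.prems base w in \<open>auto simp: site_pmf_def E_fst\<close>)
      then show ?thesis using True vv0 by (simp add: hh_def h_0)
    next
      case False
      then show ?thesis using base vv0 by (simp add: hh_def)
    qed
  next
    case (Suc n)
    have fin: "finite A" "finite B" using Suc finite_subset by blast+
    define A' where "A' = A - {Suc n}"
    have fA': "finite A'" "A' \<subseteq> {1..X}" "Suc n \<notin> A'" using fin Suc.prems by (auto simp: A'_def)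
    define G where "G c = (\<Prod>i\<in>A'. vv n i c) * (\<Prod>j\<in>B. ind (h X j c))" for c
    define g where "g = s ^ card A' * w ^ card B"
    have vvA': "(\<Prod>i\<in>A'. vv (Suc n) i c) = (\<Prod>i\<in>A'. vv n i c)" for c
      by (rule prod.cong) (use fA' in \<open>auto simp: vv_def le_Suc_eq\<close>)
    have G: "G (c((Suc n, Suc Y) := u)) = G c" for c u
    proof -
      have "vv n i (c((Suc n, Suc Y) := u)) = vv n i c" for i
        by (auto simp: vv_def v_indep)
      moreover have "(\<Prod>j\<in>B. ind (h X j (c((Suc n, Suc Y) := u)))) = (\<Prod>j\<in>B. ind (h X j c))"
        using Suc.prems by (intro prod.cong) (auto simp: h_indep)
      ultimately show ?thesis by (simp add: G_def)
    qed
    have insA': "(\<Prod>i\<in>insert (Suc n) A'. vv n i c) = vv n (Suc n) c * (\<Prod>i\<in>A'. vv n i c)"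
      "card (insert (Suc n) A') = Suc (card A')" for c
      using fA' by simp_all
    have vn: "vv n (Suc n) c = ind (v (Suc n) Y c)" "vv (Suc n) (Suc n) c = ind (v (Suc n) (Suc Y) c)" for c
      by (auto simp: vv_def)
    have sub: "insert (Suc n) A' \<subseteq> {1..X}" "n \<le> X" using fA' Suc.prems by auto
    have W: "E (\<lambda>c. G c * ind (h n (Suc Y) c)) = g * w"
      using Suc.IH[of A' B True] Suc.prems fA' by (simp add: G_def g_def hh_def)
    have S: "E (\<lambda>c. G c * ind (v (Suc n) Y c)) = g * s"
      using Suc.IH[of "insert (Suc n) A'" B False] Suc.prems sub
      by (simp add: G_def g_def hh_def insA' vn mult_ac)
    have WS: "E (\<lambda>c. G c * (ind (h n (Suc Y) c) * ind (v (Suc n) Y c))) = g * (w * s)"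
      using Suc.IH[of "insert (Suc n) A'" B True] Suc.prems sub
      by (simp add: G_def g_def hh_def insA' vn mult_ac)
    have le: "Suc n \<le> N" "Suc Y \<le> M" using Suc.prems assms(1) \<open>Suc Y \<le> M\<close> by auto
    note out = E_out[OF le G W S WS]
    \<comment> \<open>By \<open>ind_out(3)\<close> the joint moment is preserved for every choice of
      coins, so balance enters only through the single edges.\<close>
    have both: "E (\<lambda>c. G c * (ind (v (Suc n) (Suc Y) c) * ind (h (Suc n) (Suc Y) c))) = g * (w * s)"
      using WS unfolding v_Suc h_Suc ind_out(3) .
    have none: "E G = g"
      using Suc.IH[of A' B False] Suc.prems fA' by (simp add: G_def[abs_def] g_def hh_def)
    show ?case
    proof (cases "Suc n \<in> A")
      case True
      then have A: "A = insert (Suc n) A'" by (auto simp: A'_def)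
      then have "card A = Suc (card A')" using insA' by simp
      moreover have "(\<Prod>i\<in>A. vv (Suc n) i c) = ind (v (Suc n) (Suc Y) c) * (\<Prod>i\<in>A'. vv n i c)" for c
        using fA' vvA' by (simp add: A vn)
      ultimately show ?thesis using out(1) both
        by (cases t) (simp_all add: G_def g_def hh_def mult_ac)
    next
      case False
      then have "A = A'" by (auto simp: A'_def)
      then show ?thesis using out(2) none vvA'
        by (cases t) (simp_all add: G_def[abs_def] g_def hh_def mult_ac)
    qed
  qed
  define B' where "B' = B - {Suc Y}"
  have B': "B' \<subseteq> {1..Y}" "finite B'" "Suc Y \<notin> B'" using Suc.prems by (auto simp: B'_def)
  have vvX: "(\<Prod>i\<in>A. vv X i c) = (\<Prod>i\<in>A. ind (v i (Suc Y) c))" for c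
    by (rule prod.cong) (use Suc.prems in \<open>auto simp: vv_def\<close>)
  show ?case
  proof (cases "Suc Y \<in> B")
    case True
    then have B: "B = insert (Suc Y) B'" by (auto simp: B'_def)
    show ?thesis using row[of X A B' True] Suc.prems B' vvX
      by (simp add: B hh_def mult_ac)
  next
    case False
    then have "B = B'" by (auto simp: B'_def)
    then show ?thesis using row[of X A B' False] Suc.prems B' vvX
      by (simp add: hh_def mult_ac)
  qed
qed

end


section \<open>Comparison with the stationary process\<close>

abbreviation shor :: "nat \<Rightarrow> nat \<Rightarrow> (nat \<times> nat \<Rightarrow> bool \<times> bool) \<Rightarrow> bool" where
  "shor x y c \<equiv> hor (\<lambda>_. False) (\<lambda>_. True) c x y"

abbreviation sver :: "nat \<Rightarrow> nat \<Rightarrow> (nat \<times> nat \<Rightarrow> bool \<times> bool) \<Rightarrow> bool" where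
  "sver x y c \<equiv> ver (\<lambda>_. False) (\<lambda>_. True) c x y"

text \<open>The number of paths that enter from below a cell of width \<open>m\<close> with corner
  \<open>(X, Y)\<close>, whose first vertex is \<open>(X + 1, Y + 1)\<close>; \<open>hsum\<close>
  counts those entering from the left. The value \<open>vsum X 0 Y\<close> is the height.\<close>

definition vsum :: "nat \<Rightarrow> nat \<Rightarrow> nat \<Rightarrow> (nat \<times> nat \<Rightarrow> bool \<times> bool) \<Rightarrow> real" where
  "vsum m X Y c = (\<Sum>a<m. ind (sver (X + Suc a) Y c))"

definition hsum :: "nat \<Rightarrow> nat \<Rightarrow> nat \<Rightarrow> (nat \<times> nat \<Rightarrow> bool \<times> bool) \<Rightarrow> real" where
  "hsum n X Y c = (\<Sum>b<n. ind (shor X (Y + Suc b) c))"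

lemma sum_swap_pairs:
  "(\<Sum>i\<in>A. \<Sum>j\<in>B. \<Sum>a\<in>C. \<Sum>b\<in>D. f i j a b) = (\<Sum>a\<in>C. \<Sum>b\<in>D. \<Sum>i\<in>A. \<Sum>j\<in>B. f i j a b)"
proof -
  have "(\<Sum>j\<in>B. \<Sum>a\<in>C. \<Sum>b\<in>D. f i j a b) = (\<Sum>a\<in>C. \<Sum>b\<in>D. \<Sum>j\<in>B. f i j a b)" for i
    by (subst sum.swap) (intro sum.cong refl sum.swap)
  moreover have "(\<Sum>i\<in>A. \<Sum>a\<in>C. \<Sum>b\<in>D. g i a b) = (\<Sum>a\<in>C. \<Sum>b\<in>D. \<Sum>i\<in>A. g i a b)" for g
    by (subst sum.swap) (intro sum.cong refl sum.swap)
  ultimately show ?thesis by simp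
qed

lemma sum_less_exists:
  fixes f g :: "'a \<Rightarrow> real"
  shows "(\<Sum>i\<in>A. f i) < (\<Sum>i\<in>A. g i) \<Longrightarrow> \<exists>i\<in>A. f i < g i"
  by (meson sum_mono not_less)

context stationary_box
begin

section \<open>Concentration of the stationary edge counts\<close>

lemma Pr_eq_E: "Pr A = E (\<lambda>c. ind (A c))"
proof -
  have "(\<lambda>c. ind (A c)) = indicat_real {c. A c}" by (auto simp: fun_eq_iff indicator_def)
  then show ?thesis by simp
qed

lemma Pr_mono: "(\<And>c. A c \<Longrightarrow> B c) \<Longrightarrow> Pr A \<le> Pr B"
  by (intro measure_pmf.finite_measure_mono) auto

lemma Pr_disj: "Pr (\<lambda>c. A c \<or> B c) \<le> Pr A + Pr B"
proof -
  have "{c. A c \<or> B c} = {c. A c} \<union> {c. B c}" by auto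
  then show ?thesis using measure_subadditive[of "{c. A c}" "measure_pmf P" "{c. B c}"] by simp
qed

text \<open>Chebyshev's inequality for pairwise uncorrelated indicators, with each variance bounded
  crudely by 1.\<close>

lemma chebyshev:
  fixes q d :: real
  assumes I: "finite I" "I \<noteq> {}" and q: "0 \<le> q" "q \<le> 1" and d: "d > 0"
    and Z: "\<And>i. i \<in> I \<Longrightarrow> E (\<lambda>c. ind (Z i c)) = q"
    and ZZ: "\<And>i j. i \<in> I \<Longrightarrow> j \<in> I \<Longrightarrow> i \<noteq> j \<Longrightarrow> E (\<lambda>c. ind (Z i c) * ind (Z j c)) = q\<^sup>2"
  shows "Pr (\<lambda>c. \<bar>(\<Sum>i\<in>I. ind (Z i c)) - card I * q\<bar> \<ge> card I * d) \<le> 1 / (card I * d\<^sup>2)"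
proof -
  let ?n = "real (card I)" and ?S = "\<lambda>c. (\<Sum>i\<in>I. ind (Z i c)) - card I * q"
  have n: "?n > 0" using I by (simp add: card_gt_0_iff)
  have cov: "E (\<lambda>c. (ind (Z i c) - q) * (ind (Z j c) - q)) \<le> (if i = j then 1 else 0)"
    if "i \<in> I" "j \<in> I" for i j
  proof -
    have "E (\<lambda>c. (ind (Z i c) - q) * (ind (Z j c) - q))
        = E (\<lambda>c. ind (Z i c) * ind (Z j c) - q * ind (Z i c) - q * ind (Z j c) + q\<^sup>2)"
      by (simp add: algebra_simps power2_eq_square)
    also have "\<dots> = E (\<lambda>c. ind (Z i c) * ind (Z j c)) - q * q - q * q + q\<^sup>2"
      by (simp add: Z that)
    also have "\<dots> \<le> (if i = j then 1 else 0)"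
    proof (cases "i = j")
      case True
      have "E (\<lambda>c. ind (Z i c) * ind (Z i c)) = q"
        using Z[OF that(1)] by (simp add: of_bool_conj[symmetric])
      moreover have "q - q * q \<le> 1" using q mult_nonneg_nonneg[OF q(1) q(1)] by linarith
      ultimately show ?thesis using True by (simp only: power2_eq_square simp_thms if_True)
    qed (simp add: ZZ that power2_eq_square)
    finally show ?thesis .
  qed
  have "E (\<lambda>c. (?S c)\<^sup>2) = (\<Sum>i\<in>I. \<Sum>j\<in>I. E (\<lambda>c. (ind (Z i c) - q) * (ind (Z j c) - q)))"
  proof -
    have "(?S c)\<^sup>2 = (\<Sum>i\<in>I. \<Sum>j\<in>I. (ind (Z i c) - q) * (ind (Z j c) - q))" for c
    proof -
      have "?S c = (\<Sum>i\<in>I. ind (Z i c) - q)" by (simp add: sum_subtractf)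
      then show ?thesis by (simp only: power2_eq_square sum_product)
    qed
    then show ?thesis by simp
  qed
  also have "\<dots> \<le> (\<Sum>i\<in>I. \<Sum>j\<in>I. if i = j then 1 else 0)"
    by (intro sum_mono cov)
  also have "\<dots> = ?n" using I by simp
  finally have S: "E (\<lambda>c. (?S c)\<^sup>2) \<le> ?n" .
  have "Pr (\<lambda>c. \<bar>?S c\<bar> \<ge> ?n * d) * (?n * d)\<^sup>2 = E (\<lambda>c. ind (\<bar>?S c\<bar> \<ge> ?n * d) * (?n * d)\<^sup>2)"
    unfolding Pr_eq_E by simp
  also have "\<dots> \<le> E (\<lambda>c. (?S c)\<^sup>2)"
  proof (intro integral_mono integrable_P)
    fix c
    show "ind (\<bar>?S c\<bar> \<ge> ?n * d) * (?n * d)\<^sup>2 \<le> (?S c)\<^sup>2"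
    proof (cases "\<bar>?S c\<bar> \<ge> ?n * d")
      case True
      then have "(?n * d)\<^sup>2 \<le> \<bar>?S c\<bar>\<^sup>2" using n d by (intro power_mono) auto
      then show ?thesis using True by simp
    qed simp
  qed
  finally have "Pr (\<lambda>c. \<bar>?S c\<bar> \<ge> ?n * d) * (?n * d)\<^sup>2 \<le> ?n" using S by linarith
  then have "Pr (\<lambda>c. \<bar>?S c\<bar> \<ge> ?n * d) \<le> ?n / (?n * d)\<^sup>2"
    using n d by (simp add: pos_le_divide_eq)
  then show ?thesis using n by (simp add: power2_eq_square mult_ac)
qed

lemma cheb_v:
  assumes "X + m \<le> N" "Y \<le> M" "m > 0" "d > 0"
  shows "Pr (\<lambda>c. \<bar>(\<Sum>a<m. ind (v (X + Suc a) Y c)) - m * s\<bar> \<ge> m * d) \<le> 1 / (m * d\<^sup>2)"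
proof -
  have "E (\<lambda>c. ind (v (X + Suc a) Y c)) = s" if "a < m" for a
    using burke[of N Y "{X + Suc a}" "{}"] assms that by simp
  moreover have "E (\<lambda>c. ind (v (X + Suc a) Y c) * ind (v (X + Suc b) Y c)) = s\<^sup>2"
    if "a < m" "b < m" "a \<noteq> b" for a b
    using burke[of N Y "{X + Suc a, X + Suc b}" "{}"] assms that by (simp add: numeral_2_eq_2)
  ultimately show ?thesis
    using chebyshev[of "{..<m}" s d "\<lambda>a. v (X + Suc a) Y"] assms s by auto
qed

lemma cheb_h:
  assumes "X \<le> N" "Y + n \<le> M" "n > 0" "d > 0"
  shows "Pr (\<lambda>c. \<bar>(\<Sum>b<n. ind (h X (Y + Suc b) c)) - n * w\<bar> \<ge> n * d) \<le> 1 / (n * d\<^sup>2)"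
proof -
  have "E (\<lambda>c. ind (h X (Y + Suc b) c)) = w" if "b < n" for b
    using burke[of X M "{}" "{Y + Suc b}"] assms that by simp
  moreover have "E (\<lambda>c. ind (h X (Y + Suc a) c) * ind (h X (Y + Suc b) c)) = w\<^sup>2"
    if "a < n" "b < n" "a \<noteq> b" for a b
    using burke[of X M "{}" "{Y + Suc a, Y + Suc b}"] assms that by (simp add: numeral_2_eq_2)
  ultimately show ?thesis
    using chebyshev[of "{..<n}" w d "\<lambda>b. h X (Y + Suc b)"] assms w by auto
qed

text \<open>An intermediate evolution with stationary bottom and empty left side lies below both
  processes. Its conservation law turns the comparison of the exits on the right into one of
  heights.\<close>

lemma vsum_ge:
  "vsum X 0 Y c \<ge> (\<Sum>i<X. ind (v (Suc i) 0 c)) - (\<Sum>j<Y. ind (h X (Suc j) c))"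
proof -
  let ?b = "\<lambda>i. fst (c (i, 0))"
  have "(\<Sum>i<X. ind (ver (\<lambda>_. False) ?b c (Suc i) Y)) \<le> (\<Sum>i<X. ind (sver (Suc i) Y c))"
    using edge_mono(2)[of "\<lambda>_. False" "\<lambda>_. False" ?b "\<lambda>_. True" c]
    by (intro sum_mono) auto
  moreover have "(\<Sum>j<Y. ind (hor (\<lambda>_. False) ?b c X (Suc j))) \<le> (\<Sum>j<Y. ind (h X (Suc j) c))"
    using edge_mono(1)[of "\<lambda>_. False" "\<lambda>j. fst (c (0, j))" ?b ?b c]
    by (intro sum_mono) (auto simp: h_def)
  ultimately show ?thesis
    using box_conserve[where l = "\<lambda>_. False" and b = ?b and c = c and N = X and M = Y]
    by (simp add: vsum_def v_0)
qed

lemma lower_tail: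
  assumes "X \<le> N" "Y \<le> M" "X > 0" "Y > 0" "d > 0"
  shows "Pr (\<lambda>c. vsum X 0 Y c < X * (s - d) - Y * (w + d)) \<le> 1 / (X * d\<^sup>2) + 1 / (Y * d\<^sup>2)"
proof -
  have "Pr (\<lambda>c. vsum X 0 Y c < X * (s - d) - Y * (w + d))
    \<le> Pr (\<lambda>c. \<bar>(\<Sum>a<X. ind (v (0 + Suc a) 0 c)) - X * s\<bar> \<ge> X * d \<or>
       \<bar>(\<Sum>b<Y. ind (h X (0 + Suc b) c)) - Y * w\<bar> \<ge> Y * d)"
  proof (rule Pr_mono)
    fix c
    assume "vsum X 0 Y c < X * (s - d) - Y * (w + d)"
    then have "(\<Sum>a<X. ind (v (0 + Suc a) 0 c)) - (\<Sum>b<Y. ind (h X (0 + Suc b) c))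
        < (X * s - X * d) - (Y * w + Y * d)"
      using vsum_ge[where X = X and Y = Y and c = c] by (simp add: right_diff_distrib distrib_left)
    then show "\<bar>(\<Sum>a<X. ind (v (0 + Suc a) 0 c)) - X * s\<bar> \<ge> X * d \<or>
       \<bar>(\<Sum>b<Y. ind (h X (0 + Suc b) c)) - Y * w\<bar> \<ge> Y * d"
      by linarith
  qed
  also have "\<dots> \<le> 1 / (X * d\<^sup>2) + 1 / (Y * d\<^sup>2)"
    by (rule order_trans[OF Pr_disj add_mono[OF cheb_v cheb_h]]) (use assms in auto)
  finally show ?thesis .
qed

section \<open>Annihilation inside a cell and rarity of bad cells\<close>

lemma E_pattern:
  assumes "finite R" "R \<subseteq> {..N} \<times> {..M}" "\<And>z c u. z \<in> R \<Longrightarrow> G (c(z := u)) = G c"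
  shows "E (\<lambda>c. G c * ind (\<forall>z\<in>R. c z = \<pi> z)) = E G * (\<Prod>z\<in>R. pmf (p z) (\<pi> z))"
  using assms
proof (induction R rule: finite_induct)
  case (insert z R)
  have "E (\<lambda>c. G c * ind (\<forall>z\<in>insert z R. c z = \<pi> z))
      = E (\<lambda>c. (G c * ind (\<forall>z\<in>R. c z = \<pi> z)) * ind (c z = \<pi> z))"
    by (simp add: of_bool_conj mult_ac)
  also have "\<dots> = E (\<lambda>c. G c * ind (\<forall>z\<in>R. c z = \<pi> z)) * measure_pmf.expectation (p z) (\<lambda>u. ind (u = \<pi> z))"
  proof (rule E_site)
    fix c u
    have "(\<forall>y\<in>R. (c(z := u)) y = \<pi> y) = (\<forall>y\<in>R. c y = \<pi> y)" using insert.hyps by auto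
    moreover have "G (c(z := u)) = G c" by (rule insert.prems) simp
    ultimately show "G (c(z := u)) * ind (\<forall>y\<in>R. (c(z := u)) y = \<pi> y) = G c * ind (\<forall>y\<in>R. c y = \<pi> y)"
      by simp
  qed (use insert.prems in auto)
  also have "measure_pmf.expectation (p z) (\<lambda>u. ind (u = \<pi> z)) = pmf (p z) (\<pi> z)"
  proof -
    have "(\<lambda>u. ind (u = \<pi> z)) = indicat_real {\<pi> z}" by (auto simp: fun_eq_iff indicator_def)
    then show ?thesis by (simp add: measure_pmf_single)
  qed
  finally show ?case using insert by simp
qed simp

text \<open>Opposite discrepancies on the two entrance sides of a cell: the step process has a
  surplus below, the stationary process one on the left.\<close>

definition clash :: "nat \<Rightarrow> nat \<Rightarrow> nat \<Rightarrow> nat \<Rightarrow> (nat \<times> nat \<Rightarrow> bool \<times> bool) \<Rightarrow> bool" where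
  "clash a b X Y c \<longleftrightarrow> sver (X + Suc a) Y c \<and> \<not> v (X + Suc a) Y c \<and>
     \<not> shor X (Y + Suc b) c \<and> h X (Y + Suc b) c"

text \<open>A lower bound for the probability of either coin value used for steering,
  \<open>(True, True)\<close> and \<open>(True, False)\<close>.\<close>

definition \<kappa> where "\<kappa> = min (b1 * b2) (b1 * (1 - b2))"

abbreviation lst where
  "lst x y c \<equiv> lost (\<lambda>_. False) (\<lambda>_. True) (\<lambda>j. fst (c (0, j))) (\<lambda>i. fst (c (i, 0))) c x y"

lemma kappa: "0 < \<kappa>" "\<kappa> \<le> 1"
  using b1 b2 mult_le_one[of b1 b2] by (auto simp: \<kappa>_def intro: min.coboundedI1)

text \<open>Coins \<open>(True, True)\<close> let every path go straight through a vertex, whereas \<open>(True, False)\<close>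
  sends any single path up. So a prescription of the coins in a rectangle brings two opposite
  discrepancies on its west and south sides together and makes them annihilate.\<close>

lemma clash_lost:
  assumes "a < m" "b < n" "X + m \<le> N" "Y + n \<le> M"
  shows "2 * \<kappa> ^ (m * n) * Pr (clash a b X Y) \<le> E (lst (X + a) (Y + b))"
proof -
  let ?R = "{X + 1..X + m} \<times> {Y + 1..Y + n}"
  let ?\<pi> = "\<lambda>z. if z = (X + Suc a, Y + Suc b) then (True, False) else (True, True)"
  \<comment> \<open>The clash is decided by coins weakly left of column \<open>X\<close> or weakly
    below row \<open>Y\<close>, hence independent of what is prescribed in the cell.\<close>
  have G: "clash a b X Y (c(z := u)) = clash a b X Y c" if "z \<in> ?R" for z c u
  proof -
    obtain i j where z: "z = (i, j)" by (cases z)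
    have "shor X (Y + Suc b) (c(z := u)) = shor X (Y + Suc b) c"
      by (rule conjunct1[OF edge_cong]) (use that z in auto)
    moreover have "sver (X + Suc a) Y (c(z := u)) = sver (X + Suc a) Y c"
      by (rule conjunct2[OF edge_cong]) (use that z in auto)
    ultimately show ?thesis using that z by (auto simp: clash_def h_indep v_indep)
  qed
  \<comment> \<open>Prescribing the coins of the whole cell makes the bound the same for all
    \<open>a\<close> and \<open>b\<close>.\<close>
  have "\<kappa> ^ (m * n) = (\<Prod>z\<in>?R. \<kappa>)" by simp
  also have "\<dots> \<le> (\<Prod>z\<in>?R. pmf (p z) (?\<pi> z))"
  proof (rule prod_mono)
    fix z assume z: "z \<in> ?R"
    have "\<kappa> \<le> pmf (p z) (?\<pi> z)"
      using z b1 b2 by (auto simp: site_pmf_def pmf_pair \<kappa>_def)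
    then show "0 \<le> \<kappa> \<and> \<kappa> \<le> pmf (p z) (?\<pi> z)" using kappa by simp
  qed
  finally have "\<kappa> ^ (m * n) * Pr (clash a b X Y) \<le> (\<Prod>z\<in>?R. pmf (p z) (?\<pi> z)) * Pr (clash a b X Y)"
    by (intro mult_right_mono) auto
  also have "\<dots> = E (\<lambda>c. ind (clash a b X Y c) * ind (\<forall>z\<in>?R. c z = ?\<pi> z))"
    unfolding Pr_eq_E by (subst E_pattern) (use assms G in auto)
  finally have "2 * \<kappa> ^ (m * n) * Pr (clash a b X Y)
      \<le> 2 * E (\<lambda>c. ind (clash a b X Y c) * ind (\<forall>z\<in>?R. c z = ?\<pi> z))" by simp
  also have "\<dots> = E (\<lambda>c. 2 * (ind (clash a b X Y c) * ind (\<forall>z\<in>?R. c z = ?\<pi> z)))" by simp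
  also have "\<dots> \<le> E (lst (X + a) (Y + b))"
  proof (intro integral_mono integrable_P)
    fix c
    show "2 * (ind (clash a b X Y c) * ind (\<forall>z\<in>?R. c z = ?\<pi> z)) \<le> lst (X + a) (Y + b) c"
    proof (cases "clash a b X Y c \<and> (\<forall>z\<in>?R. c z = ?\<pi> z)")
      case True
      have c: "c (X + Suc i, Y + Suc j) = ?\<pi> (X + Suc i, Y + Suc j)" if "i \<le> a" "j \<le> b" for i j
        using True that assms by (auto simp del: split_paired_All)
      have "lst (X + a) (Y + b) c = 2"
      proof (rule steered_lost)
        show "c (X + Suc i, Y + Suc j) = (True, True)" if "i \<le> a" "j \<le> b" "(i, j) \<noteq> (a, b)" for i j
          using c[OF that(1,2)] that(3) by auto
        show "c (X + Suc a, Y + Suc b) = (True, False)" using c[of a b] by simp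
      qed (use True in \<open>auto simp: clash_def h_def v_def\<close>)
      then show ?thesis using True by simp
    next
      case False
      have z: "ind A * ind B = 0" if "\<not> (A \<and> B)" for A B using that by simp
      show ?thesis unfolding z[OF False] using lost_nonneg by simp
    qed
  qed
  finally show ?thesis .
qed

text \<open>Distinct corners have their losses at distinct vertices, so all of them together are
  bounded by the discrepancies entering the box. This is linear in the box size although there are
  \<open>R * R\<close> corners.\<close>

lemma sum_clash_le:
  assumes "a < m" "b < n" "X0 + R + m \<le> N" "Y0 + R + n \<le> M"
  shows "2 * \<kappa> ^ (m * n) * (\<Sum>i<R. \<Sum>j<R. Pr (clash a b (X0 + i) (Y0 + j))) \<le> real N + real M"
proof -
  have "2 * \<kappa> ^ (m * n) * (\<Sum>i<R. \<Sum>j<R. Pr (clash a b (X0 + i) (Y0 + j)))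
      = (\<Sum>i<R. \<Sum>j<R. 2 * \<kappa> ^ (m * n) * Pr (clash a b (X0 + i) (Y0 + j)))"
    by (simp add: sum_distrib_left)
  also have "\<dots> \<le> (\<Sum>i<R. \<Sum>j<R. E (lst (X0 + i + a) (Y0 + j + b)))"
    by (intro sum_mono clash_lost) (use assms in auto)
  also have "\<dots> = E (\<lambda>c. \<Sum>i<R. \<Sum>j<R. lst (X0 + a + i) (Y0 + b + j) c)"
    by (simp add: ac_simps)
  also have "\<dots> \<le> E (\<lambda>c. real N + real M)"
  proof (intro integral_mono integrable_P)
    fix c
    have "(\<Sum>i<R. \<Sum>j<R. lst (X0 + a + i) (Y0 + b + j) c)
        = (\<Sum>z\<in>{..<R} \<times> {..<R}. lst (X0 + a + fst z) (Y0 + b + snd z) c)"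
      by (simp add: sum.cartesian_product split_beta)
    also have "\<dots> = (\<Sum>z\<in>(\<lambda>z. (X0 + a + fst z, Y0 + b + snd z)) ` ({..<R} \<times> {..<R}). lst (fst z) (snd z) c)"
      by (subst sum.reindex) (auto simp: inj_on_def)
    also have "\<dots> \<le> (\<Sum>z\<in>{..<N} \<times> {..<M}. lst (fst z) (snd z) c)"
      by (intro sum_mono2) (use assms lost_nonneg in auto)
    also have "\<dots> = (\<Sum>x<N. \<Sum>y<M. lst x y c)"
      by (simp add: sum.cartesian_product split_beta)
    also have "\<dots> \<le> real N + real M" by (rule sum_lost_le)
    finally show "(\<Sum>i<R. \<Sum>j<R. lst (X0 + a + i) (Y0 + b + j) c) \<le> real N + real M" .
  qed
  finally show ?thesis by simp
qed

definition bad :: "real \<Rightarrow> nat \<Rightarrow> nat \<Rightarrow> nat \<Rightarrow> nat \<Rightarrow> (nat \<times> nat \<Rightarrow> bool \<times> bool) \<Rightarrow> bool" where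
  "bad d m n X Y c \<longleftrightarrow> vsum m X Y c > m * (s + d) \<and> hsum n X Y c < n * (w - d)"

text \<open>If the stationary counts are close to their means, a bad cell has a bottom edge where
  the step process exceeds the stationary one and a left edge where it falls short, which is a
  clash.\<close>

lemma Pr_bad_le:
  assumes "X + m \<le> N" "Y + n \<le> M" "m > 0" "n > 0" "d > 0"
  shows "Pr (bad d m n X Y) \<le> 1 / (m * d\<^sup>2) + 1 / (n * d\<^sup>2) + (\<Sum>a<m. \<Sum>b<n. Pr (clash a b X Y))"
proof -
  let ?V = "\<lambda>c. \<bar>(\<Sum>a<m. ind (v (X + Suc a) Y c)) - m * s\<bar> \<ge> m * d"
  let ?H = "\<lambda>c. \<bar>(\<Sum>b<n. ind (h X (Y + Suc b) c)) - n * w\<bar> \<ge> n * d"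
  let ?C = "\<lambda>c. \<exists>a<m. \<exists>b<n. clash a b X Y c"
  have "Pr (bad d m n X Y) \<le> Pr (\<lambda>c. (?V c \<or> ?H c) \<or> ?C c)"
  proof (rule Pr_mono)
    fix c assume bad: "bad d m n X Y c"
    show "(?V c \<or> ?H c) \<or> ?C c"
    proof (rule ccontr)
      assume n: "\<not> ((?V c \<or> ?H c) \<or> ?C c)"
      from n have V: "\<not> ?V c" and H: "\<not> ?H c" by blast+
      have "(\<Sum>a<m. ind (v (X + Suc a) Y c)) < vsum m X Y c"
        using bad V unfolding bad_def distrib_left by linarith
      then have "\<exists>a\<in>{..<m}. ind (v (X + Suc a) Y c) < ind (sver (X + Suc a) Y c)"
        unfolding vsum_def by (rule sum_less_exists)
      then obtain a where a: "a < m" "sver (X + Suc a) Y c" "\<not> v (X + Suc a) Y c"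
        by (auto split: if_splits)
      have "hsum n X Y c < (\<Sum>b<n. ind (h X (Y + Suc b) c))"
        using bad H unfolding bad_def right_diff_distrib by linarith
      then have "\<exists>b\<in>{..<n}. ind (shor X (Y + Suc b) c) < ind (h X (Y + Suc b) c)"
        unfolding hsum_def by (rule sum_less_exists)
      then obtain b where "b < n" "\<not> shor X (Y + Suc b) c" "h X (Y + Suc b) c"
        by (auto split: if_splits)
      with a n show False by (auto simp: clash_def)
    qed
  qed
  also have "\<dots> \<le> Pr ?V + Pr ?H + Pr ?C"
    by (rule order_trans[OF Pr_disj add_right_mono[OF Pr_disj]])
  also have "Pr ?C \<le> (\<Sum>a<m. \<Sum>b<n. Pr (clash a b X Y))"
  proof -
    have "Pr ?C = measure_pmf.prob P (\<Union>z\<in>{..<m} \<times> {..<n}. {c. clash (fst z) (snd z) X Y c})"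
      by (rule arg_cong[where f = "measure_pmf.prob P"]) (auto; blast)
    also have "\<dots> \<le> (\<Sum>z\<in>{..<m} \<times> {..<n}. Pr (clash (fst z) (snd z) X Y))"
      by (rule measure_pmf.finite_measure_subadditive_finite) auto
    finally show ?thesis by (simp add: sum.cartesian_product split_beta)
  qed
  also have "Pr ?V \<le> 1 / (m * d\<^sup>2)" by (rule cheb_v) (use assms in auto)
  also have "Pr ?H \<le> 1 / (n * d\<^sup>2)" by (rule cheb_h) (use assms in auto)
  finally show ?thesis by simp
qed

text \<open>The first term is small relative to the number of corners for large cells. The second is
  linear in the box size, thus negligible for a fixed cell when \<open>R\<close> is of the order of
  the box.\<close>

lemma sum_bad_le:
  assumes "X0 + R + m \<le> N" "Y0 + R + n \<le> M" "m > 0" "n > 0" "d > 0"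
  shows "(\<Sum>i<R. \<Sum>j<R. Pr (bad d m n (X0 + i) (Y0 + j)))
    \<le> (real R)\<^sup>2 * (1 / (m * d\<^sup>2) + 1 / (n * d\<^sup>2)) + m * n * ((real N + real M) / (2 * \<kappa> ^ (m * n)))"
proof -
  let ?u = "1 / (m * d\<^sup>2) + 1 / (n * d\<^sup>2)"
  have "(\<Sum>i<R. \<Sum>j<R. Pr (bad d m n (X0 + i) (Y0 + j)))
    \<le> (\<Sum>i<R. \<Sum>j<R. ?u + (\<Sum>a<m. \<Sum>b<n. Pr (clash a b (X0 + i) (Y0 + j))))"
    by (intro sum_mono Pr_bad_le) (use assms in auto)
  also have "\<dots> = (real R)\<^sup>2 * ?u + (\<Sum>i<R. \<Sum>j<R. \<Sum>a<m. \<Sum>b<n. Pr (clash a b (X0 + i) (Y0 + j)))"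
    by (simp add: sum.distrib power2_eq_square)
  also have "(\<Sum>i<R. \<Sum>j<R. \<Sum>a<m. \<Sum>b<n. Pr (clash a b (X0 + i) (Y0 + j)))
      = (\<Sum>a<m. \<Sum>b<n. \<Sum>i<R. \<Sum>j<R. Pr (clash a b (X0 + i) (Y0 + j)))"
    by (rule sum_swap_pairs)
  also have "\<dots> \<le> (\<Sum>a<m. \<Sum>b<n. (real N + real M) / (2 * \<kappa> ^ (m * n)))"
  proof (intro sum_mono)
    fix a b assume "a \<in> {..<m}" "b \<in> {..<n}"
    then have "2 * \<kappa> ^ (m * n) * (\<Sum>i<R. \<Sum>j<R. Pr (clash a b (X0 + i) (Y0 + j))) \<le> real N + real M"
      by (intro sum_clash_le) (use assms in auto)
    then show "(\<Sum>i<R. \<Sum>j<R. Pr (clash a b (X0 + i) (Y0 + j))) \<le> (real N + real M) / (2 * \<kappa> ^ (m * n))"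
      using kappa by (simp add: pos_le_divide_eq mult_ac)
  qed
  finally show ?thesis by simp
qed

end


section \<open>The mean height\<close>

text \<open>The law of the interior coins is the same for all \<open>s\<close> and \<open>w\<close>.
  Stationary processes of every density can therefore be compared with one and the same step
  process.\<close>

lemma (in stationary_box) E_eq_interior:
  assumes F: "\<And>c c'. (\<And>z. z \<in> {1..N} \<times> {1..M} \<Longrightarrow> c z = c' z) \<Longrightarrow> F c = F c'"
  shows "E F = measure_pmf.expectation (Pi_pmf ({1..N} \<times> {1..M}) undefined
    (\<lambda>_. pair_pmf (bernoulli_pmf b1) (bernoulli_pmf b2))) F"
proof -
  let ?J = "{1..N} \<times> {1..M}"
  have "Pi_pmf ?J undefined (\<lambda>_. pair_pmf (bernoulli_pmf b1) (bernoulli_pmf b2)) = Pi_pmf ?J undefined p"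
    by (rule Pi_pmf_cong) (auto simp: site_pmf_def)
  also have "\<dots> = map_pmf (\<lambda>c z. if z \<in> ?J then c z else undefined) P"
    unfolding P_def by (rule Pi_pmf_subset) auto
  finally have "measure_pmf.expectation (Pi_pmf ?J undefined
      (\<lambda>_. pair_pmf (bernoulli_pmf b1) (bernoulli_pmf b2))) F
    = E (\<lambda>c. F (\<lambda>z. if z \<in> ?J then c z else undefined))" by simp
  also have "\<dots> = E F" by (intro Bochner_Integration.integral_cong refl F) simp
  finally show ?thesis ..
qed

text \<open>The left density that solves the balance condition for bottom density
  \<open>t\<close>.\<close>

definition flux :: "real \<Rightarrow> real \<Rightarrow> real \<Rightarrow> real" where
  "flux b1 b2 t = t * (1 - b1) / ((1 - b2) - (b1 - b2) * t)"

lemma flux_denominator: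
  fixes b1 b2 t :: real
  assumes "b2 < b1" "b1 < 1" "0 \<le> t" "t \<le> 1"
  shows "1 - b1 \<le> (1 - b2) - (b1 - b2) * t" "(1 - b2) - (b1 - b2) * t \<le> 1 - b2"
proof -
  have "(b1 - b2) * t \<le> (b1 - b2) * 1" using assms by (intro mult_left_mono) auto
  then show "1 - b1 \<le> (1 - b2) - (b1 - b2) * t" by simp
  show "(1 - b2) - (b1 - b2) * t \<le> 1 - b2" using assms by simp
qed

lemma flux_bounds:
  assumes "b2 < b1" "b1 < 1" "0 \<le> t" "t \<le> 1"
  shows "0 \<le> flux b1 b2 t" "flux b1 b2 t \<le> 1"
proof -
  note D = flux_denominator[OF assms]
  have pos: "(1 - b2) - (b1 - b2) * t > 0" using D assms by linarith
  show "0 \<le> flux b1 b2 t" using pos assms by (simp add: flux_def)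
  have "t * (1 - b2) \<le> 1 * (1 - b2)" using assms by (intro mult_right_mono) auto
  then have "t * (1 - b1) \<le> (1 - b2) - (b1 - b2) * t" by (simp add: algebra_simps)
  then show "flux b1 b2 t \<le> 1" using pos by (simp add: flux_def)
qed

declare sum_of_bool_eq [simp del]

section \<open>Path counts on the sides of a cell\<close>

lemma sum_ind_bounds: "0 \<le> (\<Sum>i<k. ind (p i))" "(\<Sum>i<k. ind (p i)) \<le> real k"
  using sum_bounded_above[of "{..<k}" "\<lambda>i. ind (p i)" 1] by (auto intro: sum_nonneg)

lemma vsum_nonneg: "0 \<le> vsum m X Y c" and vsum_le: "vsum m X Y c \<le> real m"
  and hsum_nonneg: "0 \<le> hsum n X Y c" and hsum_le: "hsum n X Y c \<le> real n"
  unfolding vsum_def hsum_def by (rule sum_ind_bounds)+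

lemma vsum_add: "vsum (X + m) 0 Y c = vsum X 0 Y c + vsum m X Y c"
proof -
  have "vsum k X Y c = (\<Sum>i\<in>{X..<X + k}. ind (sver (Suc i) Y c))" for k X
    unfolding vsum_def by (rule sum.reindex_bij_witness[of _ "\<lambda>i. i - X" "\<lambda>a. X + a"]) auto
  note e = this
  show ?thesis unfolding e by (simp add: sum.atLeastLessThan_concat)
qed

lemma vsum_conserve: "vsum X 0 Y c = real X - hsum Y X 0 c"
  using box_conserve[where l = "\<lambda>_. False" and b = "\<lambda>_. True" and c = c and N = X and M = Y]
  by (simp add: vsum_def hsum_def)

lemma hsum_add: "hsum (Y + n) X 0 c = hsum Y X 0 c + hsum n X Y c"
proof -
  have "hsum k X Y c = (\<Sum>j\<in>{Y..<Y + k}. ind (shor X (Suc j) c))" for k Y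
    unfolding hsum_def by (rule sum.reindex_bij_witness[of _ "\<lambda>j. j - Y" "\<lambda>b. Y + b"]) auto
  note e = this
  show ?thesis unfolding e by (simp add: sum.atLeastLessThan_concat)
qed

text \<open>By conservation, the height gains the paths entering the cell from below and loses those
  leaving it on the right. The bad event concerns the left side instead; \<open>sum_shift_ge\<close>
  bridges this gap after averaging.\<close>

lemma vsum_step: "vsum (X + m) 0 (Y + n) c = vsum X 0 Y c + vsum m X Y c - hsum n (X + m) Y c"
  using vsum_conserve[of "X + m" "Y + n" c] vsum_conserve[of "X + m" Y c] hsum_add[of Y n "X + m" c]
    vsum_add[of X m Y c] by linarith

lemma vsum_cong:
  assumes "\<And>z. z \<in> {1..N} \<times> {1..M} \<Longrightarrow> c z = c' z" "X + m \<le> N" "Y \<le> M"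
  shows "vsum m X Y c = vsum m X Y c'"
  unfolding vsum_def
proof (intro sum.cong refl arg_cong[where f = ind])
  fix a assume "a \<in> {..<m}"
  then show "sver (X + Suc a) Y c = sver (X + Suc a) Y c'"
    by (intro conjunct2[OF edge_cong]) (use assms in auto)
qed

lemma hsum_cong:
  assumes "\<And>z. z \<in> {1..N} \<times> {1..M} \<Longrightarrow> c z = c' z" "X \<le> N" "Y + n \<le> M"
  shows "hsum n X Y c = hsum n X Y c'"
  unfolding hsum_def
proof (intro sum.cong refl arg_cong[where f = ind])
  fix a assume "a \<in> {..<n}"
  then show "shor X (Y + Suc a) c = shor X (Y + Suc a) c'"
    by (intro conjunct1[OF edge_cong]) (use assms in auto)
qed

text \<open>Shifting the window drops \<open>m\<close> terms, each at most \<open>C\<close>, and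
  adds nonnegative ones.\<close>

lemma sum_shift_ge:
  fixes f :: "nat \<Rightarrow> real"
  assumes "\<And>i. 0 \<le> f i" "\<And>i. f i \<le> C"
  shows "(\<Sum>i<R. f (i + m)) \<ge> (\<Sum>i<R. f i) - m * C"
proof (induction m)
  case (Suc m)
  have "(\<Sum>i<R. f (i + Suc m)) + f m = (\<Sum>i<R. f (i + m)) + f (R + m)"
    using sum.lessThan_Suc_shift[of "\<lambda>i. f (i + m)" R] by simp
  then show ?case using Suc assms(1)[of "R + m"] assms(2)[of m] by (simp add: algebra_simps)
qed simp

section \<open>The step process on the interior coins of a box\<close>

locale step_box =
  fixes b1 b2 :: real and N M :: nat
  assumes b2_pos: "0 < b2" and b2_b1: "b2 < b1" and b1_1: "b1 < 1"
begin

definition Q where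
  "Q = Pi_pmf ({1..N} \<times> {1..M}) undefined (\<lambda>_. pair_pmf (bernoulli_pmf b1) (bernoulli_pmf b2))"

abbreviation EQ :: "((nat \<times> nat \<Rightarrow> bool \<times> bool) \<Rightarrow> real) \<Rightarrow> real" where
  "EQ F \<equiv> measure_pmf.expectation Q F"

abbreviation PrQ :: "((nat \<times> nat \<Rightarrow> bool \<times> bool) \<Rightarrow> bool) \<Rightarrow> real" where
  "PrQ A \<equiv> measure_pmf.prob Q {c. A c}"

lemma stationary_box_flux: "0 \<le> t \<Longrightarrow> t \<le> 1 \<Longrightarrow> stationary_box b1 b2 t (flux b1 b2 t)"
proof
  assume t: "0 \<le> t" "t \<le> 1"
  note D = flux_denominator[OF b2_b1 b1_1 t]
  have pos: "(1 - b2) - (b1 - b2) * t > 0" using D b1_1 by linarith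
  show "t * (1 - flux b1 b2 t) * (1 - b1) = flux b1 b2 t * (1 - t) * (1 - b2)"
    using pos by (simp add: flux_def divide_simps) (simp add: algebra_simps)
qed (use b2_pos b2_b1 b1_1 flux_bounds in auto)

lemma integrable_Q [simp]: "integrable Q (F :: _ \<Rightarrow> real)"
  unfolding Q_def
  by (rule integrable_measure_pmf_finite, rule finite_subset[OF set_Pi_pmf_subset']) auto

lemma PrQ_eq_EQ: "PrQ A = EQ (\<lambda>c. ind (A c))"
proof -
  have "(\<lambda>c. ind (A c)) = indicat_real {c. A c}" by (auto simp: fun_eq_iff indicator_def)
  then show ?thesis by simp
qed

definition \<kappa> where "\<kappa> = min (b1 * b2) (b1 * (1 - b2))"

text \<open>The event of the stationary box with \<open>flux\<close> as left density. It speaks of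
  the step process alone, so all densities \<open>t\<close> can be treated under the same law
  \<open>Q\<close>.\<close>

definition bad :: "real \<Rightarrow> real \<Rightarrow> nat \<Rightarrow> nat \<Rightarrow> nat \<Rightarrow> nat \<Rightarrow> (nat \<times> nat \<Rightarrow> bool \<times> bool) \<Rightarrow> bool" where
  "bad t d m n X Y c \<longleftrightarrow> vsum m X Y c > m * (t + d) \<and> hsum n X Y c < n * (flux b1 b2 t - d)"

lemma PrQ_lower_tail:
  assumes "0 \<le> t" "t \<le> 1" "X \<le> N" "Y \<le> M" "X > 0" "Y > 0" "d > 0"
  shows "PrQ (\<lambda>c. vsum X 0 Y c < X * (t - d) - Y * (flux b1 b2 t + d)) \<le> 1 / (X * d\<^sup>2) + 1 / (Y * d\<^sup>2)"
proof -
  interpret B: stationary_box b1 b2 t "flux b1 b2 t" N M by (rule stationary_box_flux) (use assms in auto)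
  have "B.Pr (\<lambda>c. vsum X 0 Y c < X * (t - d) - Y * (flux b1 b2 t + d))
     = PrQ (\<lambda>c. vsum X 0 Y c < X * (t - d) - Y * (flux b1 b2 t + d))"
    unfolding B.Pr_eq_E PrQ_eq_EQ unfolding Q_def
  proof (rule B.E_eq_interior)
    fix c c' :: "nat \<times> nat \<Rightarrow> bool \<times> bool"
    assume c: "\<And>z. z \<in> {1..N} \<times> {1..M} \<Longrightarrow> c z = c' z"
    have "vsum X 0 Y c = vsum X 0 Y c'" by (rule vsum_cong[OF c]) (use assms in auto)
    then show "ind (vsum X 0 Y c < X * (t - d) - Y * (flux b1 b2 t + d))
        = ind (vsum X 0 Y c' < X * (t - d) - Y * (flux b1 b2 t + d))" by simp
  qed
  then show ?thesis using B.lower_tail[of X Y d] assms by simp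
qed

lemma sum_PrQ_bad_le:
  assumes "0 \<le> t" "t \<le> 1" "X0 + R + m \<le> N" "Y0 + R + n \<le> M" "m > 0" "n > 0" "d > 0"
  shows "(\<Sum>i<R. \<Sum>j<R. PrQ (bad t d m n (X0 + i) (Y0 + j)))
    \<le> (real R)\<^sup>2 * (1 / (m * d\<^sup>2) + 1 / (n * d\<^sup>2)) + real m * real n * ((real N + real M) / (2 * \<kappa> ^ (m * n)))"
proof -
  interpret B: stationary_box b1 b2 t "flux b1 b2 t" N M by (rule stationary_box_flux) (use assms in auto)
  have "PrQ (bad t d m n X Y) = B.Pr (B.bad d m n X Y)" if "X + m \<le> N" "Y + n \<le> M" for X Y
    unfolding B.Pr_eq_E PrQ_eq_EQ unfolding Q_def bad_def B.bad_def
  proof (rule B.E_eq_interior[symmetric])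
    fix c c' :: "nat \<times> nat \<Rightarrow> bool \<times> bool"
    assume c: "\<And>z. z \<in> {1..N} \<times> {1..M} \<Longrightarrow> c z = c' z"
    have "vsum m X Y c = vsum m X Y c'" by (rule vsum_cong[OF c]) (use that in auto)
    moreover have "hsum n X Y c = hsum n X Y c'" by (rule hsum_cong[OF c]) (use that in auto)
    ultimately show "ind (vsum m X Y c > m * (t + d) \<and> hsum n X Y c < n * (flux b1 b2 t - d))
        = ind (vsum m X Y c' > m * (t + d) \<and> hsum n X Y c' < n * (flux b1 b2 t - d))" by simp
  qed
  then have "(\<Sum>i<R. \<Sum>j<R. PrQ (bad t d m n (X0 + i) (Y0 + j)))
      = (\<Sum>i<R. \<Sum>j<R. B.Pr (B.bad d m n (X0 + i) (Y0 + j)))"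
    using assms by (intro sum.cong refl) auto
  then show ?thesis using B.sum_bad_le[of X0 R m Y0 n d] assms by (simp add: \<kappa>_def B.\<kappa>_def)
qed

text \<open>The bottom density is located on the grid of multiples of \<open>1 / g\<close>. If no
  grid density is bad, the left side carries nearly the flux of a grid point at most
  \<open>1 / g + d\<close> below, and \<open>V\<close> bounds the difference. Otherwise the trivial
  bound \<open>m\<close> is paid.\<close>

lemma drift_le_pathwise:
  fixes g :: nat
  assumes V: "\<And>t. 0 \<le> t \<Longrightarrow> t \<le> 1 \<Longrightarrow> m * t - n * flux b1 b2 t \<le> V" and g: "g > 0" and d: "d > 0"
  shows "vsum m X Y c - hsum n X Y c
    \<le> V + m / g + (real m + real n) * d + m * (\<Sum>i<g. ind (bad (i / g) d m n X Y c))"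
proof (cases "\<exists>i<g. bad (i / g) d m n X Y c")
  case True
  then obtain i where i: "i < g" "bad (i / g) d m n X Y c" by blast
  have "1 \<le> (\<Sum>i<g. ind (bad (i / g) d m n X Y c))"
    using member_le_sum[of i "{..<g}" "\<lambda>i. ind (bad (i / g) d m n X Y c)"] i
    by simp
  then have "real m * 1 \<le> m * (\<Sum>i<g. ind (bad (i / g) d m n X Y c))"
    by (rule mult_left_mono) simp
  moreover have "V \<ge> 0" using V[of 0] by (simp add: flux_def)
  moreover have "real m / g \<ge> 0" "(real m + real n) * d \<ge> 0" using d by auto
  ultimately show ?thesis
    using vsum_le[of m X Y c] hsum_nonneg[of n X Y c] by linarith
next
  case False
  \<comment> \<open>The least grid index that covers the bottom density up to \<open>d\<close>. Its
    predecessor, if any, is exceeded, so the absence of bad densities yields a lower bound for the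
    left side.\<close>
  define i where "i = (LEAST i. vsum m X Y c \<le> m * (real i / g + d))"
  have ex: "vsum m X Y c \<le> m * (real g / g + d)"
    using vsum_le[of m X Y c] g d mult_left_mono[of 1 "1 + d" "real m"] by simp
  have i: "vsum m X Y c \<le> m * (real i / g + d)" unfolding i_def by (rule LeastI[of _ g]) (rule ex)
  have ig: "i \<le> g" unfolding i_def by (rule Least_le) (rule ex)
  have "vsum m X Y c - hsum n X Y c \<le> V + m / g + (real m + real n) * d"
  proof (cases i)
    case 0
    then have "vsum m X Y c \<le> m * d" using i by simp
    moreover have "V \<ge> 0" using V[of 0] by (simp add: flux_def)
    moreover have "real m / g \<ge> 0" "real n * d \<ge> 0" using d by auto
    ultimately show ?thesis using hsum_nonneg[of n X Y c] unfolding distrib_right by linarith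
  next
    case (Suc k)
    have "\<not> vsum m X Y c \<le> m * (real k / g + d)"
      using not_less_Least[of k "\<lambda>i. vsum m X Y c \<le> m * (real i / g + d)"] Suc by (simp add: i_def)
    moreover have "\<not> bad (k / g) d m n X Y c" using False ig Suc by auto
    ultimately have "hsum n X Y c \<ge> n * (flux b1 b2 (k / g) - d)" by (auto simp: bad_def)
    moreover have "real k / g \<le> 1" using ig Suc by simp
    then have "m * (k / g) - n * flux b1 b2 (k / g) \<le> V" by (intro V) auto
    moreover have "m * (real i / g + d) = m * (k / g) + m / g + m * d"
      using Suc by (simp add: add_divide_distrib distrib_left)
    ultimately show ?thesis using i by (simp add: right_diff_distrib distrib_right)
  qed
  then show ?thesis using False by simp
qed

lemma drift_le:
  fixes g :: nat
  assumes V: "\<And>t. 0 \<le> t \<Longrightarrow> t \<le> 1 \<Longrightarrow> m * t - n * flux b1 b2 t \<le> V" and g: "g > 0" and d: "d > 0"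
    and box: "X0 + R + m \<le> N" "Y0 + R + n \<le> M" and pos: "m > 0" "n > 0"
  shows "(\<Sum>i<R. \<Sum>j<R. EQ (vsum m (X0 + i) (Y0 + j)) - EQ (hsum n (X0 + i) (Y0 + j)))
    \<le> (real R)\<^sup>2 * (V + m / g + (real m + real n) * d)
      + real m * real g * ((real R)\<^sup>2 * (1 / (m * d\<^sup>2) + 1 / (n * d\<^sup>2))
        + real m * real n * ((real N + real M) / (2 * \<kappa> ^ (m * n))))"
proof -
  let ?B = "(real R)\<^sup>2 * (1 / (m * d\<^sup>2) + 1 / (n * d\<^sup>2)) + real m * real n * ((real N + real M) / (2 * \<kappa> ^ (m * n)))"
  let ?A = "V + m / g + (real m + real n) * d"
  have 1: "EQ (vsum m X Y) - EQ (hsum n X Y) \<le> ?A + m * (\<Sum>k<g. PrQ (bad (k / g) d m n X Y))" for X Y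
  proof -
    have "EQ (vsum m X Y) - EQ (hsum n X Y) = EQ (\<lambda>c. vsum m X Y c - hsum n X Y c)" by simp
    also have "\<dots> \<le> EQ (\<lambda>c. ?A + m * (\<Sum>k<g. ind (bad (k / g) d m n X Y c)))"
      by (intro integral_mono integrable_Q drift_le_pathwise[OF V g d]) auto
    also have "\<dots> = ?A + m * (\<Sum>k<g. PrQ (bad (k / g) d m n X Y))"
      unfolding PrQ_eq_EQ by simp
    finally show ?thesis .
  qed
  have "(\<Sum>i<R. \<Sum>j<R. EQ (vsum m (X0 + i) (Y0 + j)) - EQ (hsum n (X0 + i) (Y0 + j)))
    \<le> (\<Sum>i<R. \<Sum>j<R. ?A + m * (\<Sum>k<g. PrQ (bad (k / g) d m n (X0 + i) (Y0 + j))))"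
    by (intro sum_mono 1)
  also have "\<dots> = (real R)\<^sup>2 * ?A + m * (\<Sum>i<R. \<Sum>j<R. \<Sum>k<g. PrQ (bad (k / g) d m n (X0 + i) (Y0 + j)))"
    by (simp add: sum.distrib power2_eq_square sum_distrib_left)
  \<comment> \<open>A one-point index set of type \<open>unit\<close> provides the fourth sum for
    \<open>sum_swap_pairs\<close>.\<close>
  also have "(\<Sum>i<R. \<Sum>j<R. \<Sum>k<g. PrQ (bad (k / g) d m n (X0 + i) (Y0 + j)))
     = (\<Sum>k<g. \<Sum>i<R. \<Sum>j<R. PrQ (bad (k / g) d m n (X0 + i) (Y0 + j)))"
    using sum_swap_pairs[of "\<lambda>i j k (u::unit). PrQ (bad (k / g) d m n (X0 + i) (Y0 + j))"
        UNIV "{..<g}" "{..<R}" "{..<R}"] by (simp add: UNIV_unit)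
  also have "m * (\<Sum>k<g. \<Sum>i<R. \<Sum>j<R. PrQ (bad (k / g) d m n (X0 + i) (Y0 + j))) \<le> m * (g * ?B)"
  proof (rule mult_left_mono)
    have "(\<Sum>i<R. \<Sum>j<R. PrQ (bad (k / g) d m n (X0 + i) (Y0 + j))) \<le> ?B" if "k < g" for k
      by (rule sum_PrQ_bad_le) (use that d box pos in auto)
    then have "(\<Sum>k<g. \<Sum>i<R. \<Sum>j<R. PrQ (bad (k / g) d m n (X0 + i) (Y0 + j))) \<le> (\<Sum>k<g. ?B)"
      by (intro sum_mono) auto
    then show "(\<Sum>k<g. \<Sum>i<R. \<Sum>j<R. PrQ (bad (k / g) d m n (X0 + i) (Y0 + j))) \<le> g * ?B"
      by (simp only: sum_constant card_lessThan)
  qed simp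
  finally show ?thesis by (simp only: mult.assoc)
qed

section \<open>Iterating the cell bound for the mean height\<close>

definition U :: "nat \<Rightarrow> nat \<Rightarrow> real" where
  "U X Y = EQ (vsum X 0 Y)"

lemma U_step: "U (X + m) (Y + n) = U X Y + EQ (vsum m X Y) - EQ (hsum n (X + m) Y)"
proof -
  have "U (X + m) (Y + n) = EQ (\<lambda>c. vsum X 0 Y c + vsum m X Y c - hsum n (X + m) Y c)"
    unfolding U_def by (intro Bochner_Integration.integral_cong refl vsum_step)
  then show ?thesis by (simp add: U_def)
qed

lemma EQ_between: "(\<And>c. l \<le> F c) \<Longrightarrow> l \<le> EQ F" "(\<And>c. F c \<le> u) \<Longrightarrow> EQ F \<le> u"
  using integral_mono[of Q "\<lambda>_. l" F] integral_mono[of Q F "\<lambda>_. u"] by auto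

lemma U_le: "U X Y \<le> X"
  unfolding U_def by (rule EQ_between) (rule vsum_le)

lemma U_le_shift: "U X Y \<le> U (X + i) (Y + j) + j"
  using U_step[of X i Y j] EQ_between(1)[of 0 "vsum i X Y", OF vsum_nonneg]
    EQ_between(2)[of "hsum j (X + i) Y", OF hsum_le]
  by linarith

text \<open>The mean height increases in \<open>X\<close> and decreases in \<open>Y\<close>, by at
  most one per unit. Truncated subtraction keeps only the displacements that can make the left side
  larger.\<close>

lemma U_le_U:
  "U X Y \<le> U X' Y' + real (X - X') + real (Y' - Y)"
proof -
  have a: "U X Y \<le> U X Y' + real (Y' - Y)"
  proof (cases "Y \<le> Y'")
    case True
    then show ?thesis using U_le_shift[of X Y 0 "Y' - Y"] by simp
  next
    case False
    then have "U X Y \<le> U X Y'"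
      using U_step[of X 0 Y' "Y - Y'"] EQ_between(1)[of 0 "hsum (Y - Y') X Y'", OF hsum_nonneg]
      by (simp add: vsum_def[abs_def])
    then show ?thesis by simp
  qed
  have b: "U X Y' \<le> U X' Y' + real (X - X')"
  proof (cases "X \<le> X'")
    case True
    then show ?thesis using U_le_shift[of X Y' "X' - X" 0] by simp
  next
    case False
    then show ?thesis
      using U_step[of X' "X - X'" Y' 0] EQ_between(2)[of "vsum (X - X') X' Y'", OF vsum_le]
      by (simp add: hsum_def[abs_def])
  qed
  from a b show ?thesis by linarith
qed

text \<open>Averaging over an \<open>R\<close> by \<open>R\<close> square of starting points makes the difference between
  the left and the right side of a cell negligible, so that the bound for a cell can be iterated
  in the direction \<open>(m, n)\<close>.\<close>

lemma mean_height_le: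
  fixes g :: nat
  assumes V: "\<And>t. 0 \<le> t \<Longrightarrow> t \<le> 1 \<Longrightarrow> m * t - n * flux b1 b2 t \<le> V" and g: "g > 0" and d: "d > 0"
    and box: "T * m + R \<le> N" "T * n + R \<le> M" and pos: "m > 0" "n > 0" "R > 0"
  shows "U (T * m) (T * n) \<le> 2 * real R + T * (V + m / g + (real m + real n) * d
      + real m * real g * (1 / (m * d\<^sup>2) + 1 / (n * d\<^sup>2))
      + real m * real g * real m * real n * (real N + real M) / (2 * \<kappa> ^ (m * n) * (real R)\<^sup>2) + real m * real n / R)"
proof -
  define A where "A = V + m / g + (real m + real n) * d"
  define B where "B = (1 / (m * d\<^sup>2) + 1 / (n * d\<^sup>2))"
  define C where "C = real m * real n * ((real N + real M) / (2 * \<kappa> ^ (m * n)))"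
  define S where "S = (real R)\<^sup>2 * A + real m * real g * ((real R)\<^sup>2 * B + C) + real R * real m * real n"
  \<comment> \<open>The total mean height over the square of corners, carried along by
    \<open>t\<close> steps of \<open>(m, n)\<close>.\<close>
  define G where "G t = (\<Sum>i<R. \<Sum>j<R. U (t * m + i) (t * n + j))" for t
  have step: "G (Suc t) \<le> G t + S" if "t < T" for t
  proof -
    have "Suc t * m \<le> T * m" "Suc t * n \<le> T * n" using that by (simp_all only: mult_le_mono1 Suc_leI)
    then have inbox: "t * m + R + m \<le> N" "t * n + R + n \<le> M" using box by simp_all
    let ?h = "\<lambda>i j. EQ (hsum n (t * m + i) (t * n + j))"
    let ?v = "\<lambda>i j. EQ (vsum m (t * m + i) (t * n + j))"
    have "G (Suc t) = (\<Sum>i<R. \<Sum>j<R. U (t * m + i) (t * n + j) + ?v i j - ?h (i + m) j)"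
      unfolding G_def
    proof (intro sum.cong refl)
      fix i j
      show "U (Suc t * m + i) (Suc t * n + j) = U (t * m + i) (t * n + j) + ?v i j - ?h (i + m) j"
        using U_step[of "t * m + i" m "t * n + j" n] by (simp add: ac_simps)
    qed
    then have GS: "G (Suc t) = G t + (\<Sum>i<R. \<Sum>j<R. ?v i j) - (\<Sum>i<R. \<Sum>j<R. ?h (i + m) j)"
      by (simp only: G_def sum.distrib sum_subtractf)
    \<comment> \<open>Passing from left to right sides of cells shifts each row of corners by
      \<open>m\<close>, which costs at most \<open>m\<close> terms of size at most
      \<open>n\<close>.\<close>
    have "(\<Sum>i<R. \<Sum>j<R. ?h i j) - real R * real m * real n = (\<Sum>j<R. \<Sum>i<R. ?h i j) - (\<Sum>j<R. m * real n)"
      by (subst sum.swap) simp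
    also have "\<dots> = (\<Sum>j<R. (\<Sum>i<R. ?h i j) - m * real n)"
      by (rule sum_subtractf[symmetric])
    also have "\<dots> \<le> (\<Sum>j<R. \<Sum>i<R. ?h (i + m) j)"
    proof (rule sum_mono)
      fix j
      show "(\<Sum>i<R. ?h i j) - m * real n \<le> (\<Sum>i<R. ?h (i + m) j)"
        by (rule sum_shift_ge[where f = "\<lambda>i. ?h i j"]; rule EQ_between; rule hsum_nonneg hsum_le)
    qed
    also have "\<dots> = (\<Sum>i<R. \<Sum>j<R. ?h (i + m) j)"
      by (rule sum.swap)
    finally have shift: "(\<Sum>i<R. \<Sum>j<R. ?h i j) - real R * real m * real n \<le> (\<Sum>i<R. \<Sum>j<R. ?h (i + m) j)" .
    have "(\<Sum>i<R. \<Sum>j<R. ?v i j - ?h i j) \<le> (real R)\<^sup>2 * A + real m * real g * ((real R)\<^sup>2 * B + C)"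
      unfolding A_def B_def C_def by (rule drift_le[OF V g d inbox pos(1,2)])
    moreover have "(\<Sum>i<R. \<Sum>j<R. ?v i j - ?h i j) = (\<Sum>i<R. \<Sum>j<R. ?v i j) - (\<Sum>i<R. \<Sum>j<R. ?h i j)"
      by (simp only: sum_subtractf)
    ultimately show ?thesis using GS shift unfolding S_def by linarith
  qed
  have "t \<le> T \<Longrightarrow> G t \<le> G 0 + t * S" for t
  proof (induction t)
    case (Suc t)
    then show ?case using step[of t] by (simp add: algebra_simps)
  qed simp
  then have G: "G T \<le> G 0 + T * S" by blast
  have "G 0 \<le> (\<Sum>i<R. \<Sum>j<R. real R)"
    unfolding G_def
  proof (intro sum_mono)
    fix i j assume "i \<in> {..<R}" "j \<in> {..<R}"
    then show "U (0 * m + i) (0 * n + j) \<le> real R" using U_le[of i j] by simp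
  qed
  then have G0: "G 0 \<le> (real R)\<^sup>2 * R" by (simp add: power2_eq_square)
  \<comment> \<open>Back from the average to the single corner: moving right does not lower the mean
    height, and moving up by less than \<open>R\<close> lowers it by at most
    \<open>R\<close>.\<close>
  have "(\<Sum>i<R. \<Sum>j<R. U (T * m) (T * n) - R) \<le> G T"
    unfolding G_def
  proof (intro sum_mono)
    fix i j assume "i \<in> {..<R}" "j \<in> {..<R}"
    then show "U (T * m) (T * n) - R \<le> U (T * m + i) (T * n + j)"
      using U_le_shift[of "T * m" "T * n" i j] by simp
  qed
  then have "(real R)\<^sup>2 * (U (T * m) (T * n) - R) \<le> (real R)\<^sup>2 * R + T * S"
    using G G0 by (simp add: power2_eq_square)
  then have "U (T * m) (T * n) - R \<le> ((real R)\<^sup>2 * R + T * S) / (real R)\<^sup>2"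
    using pos by (simp add: pos_le_divide_eq mult.commute)
  also have "\<dots> = R + T * (S / (real R)\<^sup>2)"
    using pos by (simp add: add_divide_distrib)
  also have "S / (real R)\<^sup>2 = A + real m * real g * B + real m * real g * C / (real R)\<^sup>2 + real m * real n / R"
  proof -
    have "real R \<noteq> 0" using pos by simp
    then show ?thesis
      by (simp add: S_def add_divide_distrib distrib_left power2_eq_square mult.assoc)
  qed
  also have "real m * real g * C / (real R)\<^sup>2
      = real m * real g * real m * real n * (real N + real M) / (2 * \<kappa> ^ (m * n) * (real R)\<^sup>2)"
    by (simp add: C_def)
  finally show ?thesis unfolding A_def B_def by linarith
qed

end


section \<open>The limit shape and the sampled configurations\<close>

text \<open>With the denominator \<open>D\<close> as variable, the objective is a constant minus the
  sum of \<open>x * D\<close> and a multiple of \<open>1 / D\<close>, which can be optimised without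
  derivatives.\<close>

lemma flux_value:
  assumes "b2 < b1" "b1 < 1" "0 \<le> t" "t \<le> 1"
  defines "D \<equiv> (1 - b2) - (b1 - b2) * t"
  shows "(b1 - b2) * (x * t - y * flux b1 b2 t)
    = x * (1 - b2) + y * (1 - b1) - (x * D + y * (1 - b1) * (1 - b2) / D)"
proof -
  have D: "D > 0" using flux_denominator(1)[of b2 b1 t] assms by simp
  have "(b1 - b2) * (y * flux b1 b2 t) = y * (1 - b1) * ((1 - b2) - D) / D"
    by (simp add: flux_def D_def)
  also have "\<dots> = y * (1 - b1) * (1 - b2) / D - y * (1 - b1)"
    using D by (simp add: right_diff_distrib diff_divide_distrib)
  finally show ?thesis unfolding right_diff_distrib[of "b1 - b2"] by (simp add: D_def algebra_simps)
qed

text \<open>The limit shape is a Legendre transform of the flux. In the fan the arithmetic-geometric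
  mean inequality gives the maximum; in the two frozen regions it sits at \<open>t = 0\<close> or
  \<open>t = 1\<close>.\<close>

lemma limit_height_eq_Sup:
  assumes b: "b2 < b1" "b1 < 1" and xy: "x > 0" "y > 0"
  shows "\<forall>t\<in>{0..1}. x * t - y * flux b1 b2 t \<le> limit_height b1 b2 x y"
    and "\<exists>t\<in>{0..1}. x * t - y * flux b1 b2 t = limit_height b1 b2 x y"
proof -
  define p q e where "p = 1 - b1" and "q = 1 - b2" and "e = b1 - b2"
  have pq: "0 < p" "p < q" "0 < q" and e: "e > 0" "e = q - p"
    using b by (auto simp: p_def q_def e_def)
  have lh: "limit_height b1 b2 x y = (if p / q < x / y \<and> x / y < q / p
       then (sqrt (y * p) - sqrt (x * q))\<^sup>2 / e else if x / y \<le> p / q then 0 else x - y)"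
    by (simp add: limit_height_def p_def q_def e_def)
  have val: "e * (x * t - y * flux b1 b2 t) = x * q + y * p - (x * (q - e * t) + y * p * q / (q - e * t))"
    and D: "p \<le> q - e * t" "q - e * t \<le> q" if "t \<in> {0..1}" for t
    using flux_value[of b2 b1 t x y] flux_denominator[of b2 b1 t] that b
    by (simp_all add: p_def q_def e_def)
  have flux01: "flux b1 b2 0 = 0" "flux b1 b2 1 = 1" using b by (simp_all add: flux_def)
  consider (fan) "p / q < x / y" "x / y < q / p" | (left) "x / y \<le> p / q" | (right) "x / y \<ge> q / p" "x / y > p / q"
    by linarith
  then have "(\<forall>t\<in>{0..1}. x * t - y * flux b1 b2 t \<le> limit_height b1 b2 x y) \<and>
      (\<exists>t\<in>{0..1}. x * t - y * flux b1 b2 t = limit_height b1 b2 x y)"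
  proof cases
    case fan
    define z where "z = sqrt (y * p * (x * q))"
    have sq: "(sqrt (y * p) - sqrt (x * q))\<^sup>2 = y * p + x * q - 2 * z"
    proof -
      have "sqrt (y * p) * sqrt (x * q) = z" by (simp only: z_def real_sqrt_mult)
      moreover have "0 \<le> y * p" "0 \<le> x * q" using pq xy by simp_all
      ultimately show ?thesis by (simp only: power2_diff real_sqrt_pow2 mult.assoc)
    qed
    have l: "e * limit_height b1 b2 x y = y * p + x * q - 2 * z"
      using fan e by (simp add: lh sq)
    have "x * t - y * flux b1 b2 t \<le> limit_height b1 b2 x y" if t: "t \<in> {0..1}" for t
    proof -
      let ?D = "q - e * t"
      have D0: "?D > 0" using D[OF t] pq by linarith
      have "z = sqrt ((x * ?D) * (y * p * q / ?D))" using D0 by (simp add: z_def mult_ac)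
      also have "\<dots> \<le> (x * ?D + y * p * q / ?D) / 2"
        by (rule arith_geo_mean_sqrt) (use D0 pq xy in auto)
      finally have "2 * z \<le> x * ?D + y * p * q / ?D" by simp
      then have "e * (x * t - y * flux b1 b2 t) \<le> e * limit_height b1 b2 x y"
        unfolding val[OF t] l by (intro diff_mono) simp_all
      then show ?thesis using e by simp
    qed
    moreover have "\<exists>t\<in>{0..1}. x * t - y * flux b1 b2 t = limit_height b1 b2 x y"
    proof
      \<comment> \<open>The equality case of the mean inequality, where both summands equal
        \<open>z\<close>. The fan conditions place \<open>D0\<close> between \<open>p\<close> and
        \<open>q\<close>, which puts the corresponding \<open>t\<close> into the unit
        interval.\<close>
      define D0 where "D0 = z / x"
      have z: "z > 0" "z\<^sup>2 = y * p * (x * q)" using pq xy by (simp_all add: z_def)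
      have D0: "D0 > 0" using z xy by (simp add: D0_def)
      have 1: "x * p < y * q" "y * p < x * q" using fan pq xy by (simp_all add: field_simps)
      have "(x * p)\<^sup>2 \<le> z\<^sup>2"
        unfolding z(2) using mult_left_mono[OF less_imp_le[OF 1(1)], of "x * p"] pq xy
        by (simp add: power2_eq_square mult_ac)
      then have "x * p \<le> z" using z(1) pq xy by (simp add: abs_le_square_iff[symmetric])
      then have pD: "p \<le> D0" using xy by (simp add: D0_def pos_le_divide_eq mult.commute)
      have "z\<^sup>2 \<le> (x * q)\<^sup>2"
        unfolding z(2) using mult_right_mono[OF less_imp_le[OF 1(2)], of "x * q"] pq xy
        by (simp add: power2_eq_square mult_ac)
      then have "z \<le> x * q" using z(1) pq xy by (simp add: abs_le_square_iff[symmetric])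
      then have qD: "D0 \<le> q" using xy by (simp add: D0_def pos_divide_le_eq mult.commute)
      let ?t = "(q - D0) / e"
      show t: "?t \<in> {0..1}" using pD qD e by (simp add: divide_le_eq)
      have qe: "q - e * ?t = D0" using e by simp
      have "x * D0 = z" "y * p * q / D0 = z"
        using xy z by (simp_all add: D0_def field_simps power2_eq_square)
      then have "e * (x * ?t - y * flux b1 b2 ?t) = e * limit_height b1 b2 x y"
        unfolding val[OF t] qe l by simp
      then show "x * ?t - y * flux b1 b2 ?t = limit_height b1 b2 x y" using e(1) by (metis mult_cancel_left less_irrefl)
    qed
    ultimately show ?thesis by blast
  next
    case left
    then have l: "limit_height b1 b2 x y = 0" by (simp add: lh)
    have xy': "x * q \<le> y * p" using left pq xy by (simp add: field_simps)
    have "x * t - y * flux b1 b2 t \<le> 0" if t: "t \<in> {0..1}" for t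
    proof -
      let ?D = "q - e * t"
      have D0: "?D > 0" using D[OF t] pq by linarith
      have "x * ?D \<le> x * q" using D[OF t] xy by (intro mult_left_mono) auto
      then have "x * ?D \<le> y * p" using xy' by simp
      \<comment> \<open>The gap to the value at \<open>t = 0\<close>, where the denominator is
        \<open>q\<close>, factors into nonnegative terms.\<close>
      then have "0 \<le> (q - ?D) * (y * p - x * ?D) / ?D"
        using D[OF t] D0 by (intro divide_nonneg_pos mult_nonneg_nonneg) auto
      also have "\<dots> = x * ?D + y * p * q / ?D - x * q - y * p"
        using D0 by (simp add: field_simps)
      finally have "e * (x * t - y * flux b1 b2 t) \<le> e * 0"
        unfolding val[OF t] by simp
      then show ?thesis using e by (simp only: mult_le_cancel_left_pos)
    qed
    then show ?thesis using l flux01 by (auto intro!: bexI[of _ 0])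
  next
    case right
    then have l: "limit_height b1 b2 x y = x - y" using pq by (simp add: lh)
    have xy': "y * q \<le> x * p" using right pq xy by (simp add: field_simps)
    have "x * t - y * flux b1 b2 t \<le> x - y" if t: "t \<in> {0..1}" for t
    proof -
      let ?D = "q - e * t"
      have D0: "?D > 0" using D[OF t] pq by linarith
      have "x * p \<le> x * ?D" using D[OF t] xy by (intro mult_left_mono) auto
      then have "y * q \<le> x * ?D" using xy' by simp
      \<comment> \<open>The same factorisation for the gap to the value at \<open>t = 1\<close>,
        where the denominator is \<open>p\<close>.\<close>
      then have "0 \<le> (?D - p) * (x * ?D - y * q) / ?D"
        using D[OF t] D0 by (intro divide_nonneg_pos mult_nonneg_nonneg) auto
      also have "\<dots> = x * ?D + y * p * q / ?D - x * p - y * q"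
        using D0 by (simp add: field_simps)
      finally have "e * (x * t - y * flux b1 b2 t) \<le> e * (x - y)"
        unfolding val[OF t] by (simp add: e algebra_simps)
      then show ?thesis using e by (simp only: mult_le_cancel_left_pos)
    qed
    then show ?thesis using l flux01 by (auto intro!: bexI[of _ 1])
  qed
  then show "\<forall>t\<in>{0..1}. x * t - y * flux b1 b2 t \<le> limit_height b1 b2 x y"
    and "\<exists>t\<in>{0..1}. x * t - y * flux b1 b2 t = limit_height b1 b2 x y" by blast+
qed

text \<open>An event decided by finitely many coins is a finite disjoint union of cylinders, and
  each cylinder has the mass that \<open>Q\<close> gives to the corresponding function.\<close>

lemma (in step_box) measure_coins_eq:
  assumes A: "\<And>c c'. (\<And>z. z \<in> {1..N} \<times> {1..M} \<Longrightarrow> c z = c' z) \<Longrightarrow> A c = A c'"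
  shows "measure (coins b1 b2) {c \<in> space (coins b1 b2). A c} = PrQ A"
proof -
  let ?J = "{1..N} \<times> {1..M}" and ?p = "pair_pmf (bernoulli_pmf b1) (bernoulli_pmf b2)"
  interpret product_prob_space "\<lambda>_::nat \<times> nat. measure_pmf ?p" quadrant
    by (unfold_locales)
  interpret C: prob_space "coins b1 b2"
    unfolding coins_def by (rule prob_space_axioms)
  let ?S = "PiE ?J (\<lambda>_. UNIV) :: (nat \<times> nat \<Rightarrow> bool \<times> bool) set"
  let ?cyl = "\<lambda>g. {c \<in> space (coins b1 b2). \<forall>z\<in>?J. c z = g z}"
  have J: "?J \<subseteq> quadrant" "finite ?J" by (auto simp: quadrant_def)
  have fin: "finite ?S" by (intro finite_PiE) auto
  have cyl: "?cyl g = prod_emb quadrant (\<lambda>_. measure_pmf ?p) ?J (PiE ?J (\<lambda>z. {g z}))" for g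
    unfolding coins_def prod_emb_def space_PiM
    by (rule set_eqI) (simp only: mem_Collect_eq Int_iff vimage_eq restrict_PiE_iff singleton_iff conj_commute)
  have sets: "?cyl g \<in> sets (coins b1 b2)" for g
    unfolding cyl unfolding coins_def using J by (intro sets_PiM_I) auto
  have cylm: "measure (coins b1 b2) (?cyl g) = (\<Prod>z\<in>?J. pmf ?p (g z))" for g
    unfolding cyl unfolding coins_def using J
    by (subst measure_PiM_emb) (auto simp: measure_pmf_single)
  have "{c \<in> space (coins b1 b2). A c} = (\<Union>g\<in>{g\<in>?S. A g}. ?cyl g)"
  proof (intro set_eqI iffI)
    fix c assume c: "c \<in> {c \<in> space (coins b1 b2). A c}"
    have "A (restrict c ?J) = A c" by (rule A) (simp only: restrict_apply if_True)
    then have "restrict c ?J \<in> {g\<in>?S. A g}" using c by (simp only: mem_Collect_eq restrict_PiE_iff UNIV_I) blast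
    moreover have "c \<in> ?cyl (restrict c ?J)" using c by (simp only: mem_Collect_eq restrict_apply simp_thms if_True cong: ball_cong) simp
    ultimately have "\<exists>g\<in>{g\<in>?S. A g}. c \<in> ?cyl g" by (intro bexI[where x = "restrict c ?J"])
    then show "c \<in> (\<Union>g\<in>{g\<in>?S. A g}. ?cyl g)" by (simp only: UN_iff)
  next
    fix c assume "c \<in> (\<Union>g\<in>{g\<in>?S. A g}. ?cyl g)"
    then obtain g where g: "A g" "c \<in> ?cyl g" by blast
    have "A c = A g" by (rule A) (use g in auto)
    then show "c \<in> {c \<in> space (coins b1 b2). A c}" using g by simp
  qed
  also have "measure (coins b1 b2) \<dots> = (\<Sum>g\<in>{g\<in>?S. A g}. measure (coins b1 b2) (?cyl g))"
  proof (rule C.finite_measure_finite_Union)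
    show "disjoint_family_on ?cyl {g\<in>?S. A g}"
      unfolding disjoint_family_on_def
    proof (intro ballI impI)
      fix g g' assume g: "g \<in> {g\<in>?S. A g}" "g' \<in> {g\<in>?S. A g}" "g \<noteq> g'"
      have "\<exists>z\<in>?J. g z \<noteq> g' z" using PiE_ext[of g ?J "\<lambda>_. UNIV" g'] g by blast
      then show "?cyl g \<inter> ?cyl g' = {}" by auto
    qed
  qed (use fin sets in auto)
  also have "\<dots> = (\<Sum>g\<in>{g\<in>?S. A g}. pmf Q g)"
  proof (rule sum.cong[OF refl])
    fix g assume "g \<in> {g\<in>?S. A g}"
    then have "g z = undefined" if "z \<notin> ?J" for z using PiE_arb[of g ?J _ z] that by blast
    then show "measure (coins b1 b2) (?cyl g) = pmf Q g"
      unfolding cylm Q_def by (intro pmf_Pi'[symmetric]) auto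
  qed
  also have "\<dots> = measure_pmf.prob Q {g\<in>?S. A g}"
    using fin by (intro measure_measure_pmf_finite[symmetric]) auto
  \<comment> \<open>Functions that differ from \<open>undefined\<close> somewhere outside the box
    have mass zero under \<open>Q\<close>.\<close>
  also have "\<dots> = PrQ A"
  proof (rule measure_prob_cong_0)
    fix c assume "c \<in> {c. A c} - {g\<in>?S. A g}"
    then have "c \<notin> extensional ?J" by (auto simp: PiE_iff)
    then show "pmf Q c = 0" unfolding Q_def extensional_def by (intro pmf_Pi_outside) blast+
  qed auto
  finally show ?thesis .
qed

text \<open>The south edges of row \<open>nat \<lceil>y\<rceil>\<close> are the vertical edges that
  leave the row below, hence the subtraction of one.\<close>

lemma height_function_sample_config:
  assumes "u > 0" "y > 0"
  shows "real (height_function u y (sample_config c)) = vsum (nat \<lfloor>u\<rfloor>) 0 (nat \<lceil>y\<rceil> - 1) c"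
proof -
  let ?Y = "nat \<lceil>y\<rceil>"
  have Y: "?Y \<ge> 1" using assms by linarith
  have "{i. 1 \<le> i \<and> real i \<le> u \<and> south_bold (sample_config c (i, ?Y))}
    = Suc ` ({..<nat \<lfloor>u\<rfloor>} \<inter> {i. sver (Suc i) (?Y - 1) c})" (is "?L = ?R")
  proof (intro set_eqI iffI)
    fix i assume i: "i \<in> ?L"
    then obtain k where k: "i = Suc k" by (cases i) auto
    have "k < nat \<lfloor>u\<rfloor>" using i k by (simp add: Suc_le_eq[symmetric] le_nat_iff le_floor_iff del: of_nat_Suc)
    moreover have "sver i (?Y - 1) c"
      using i Y south_west_sample_at[of i ?Y c] unfolding k by (simp add: sample_config_def quadrant_def del: south_bold.simps)
    ultimately show "i \<in> ?R" using k by auto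
  next
    fix i assume "i \<in> ?R"
    then obtain k where k: "i = Suc k" "k < nat \<lfloor>u\<rfloor>" "sver (Suc k) (?Y - 1) c" by auto
    have "real i \<le> real (nat \<lfloor>u\<rfloor>)" using k by simp
    also have "\<dots> \<le> u" using assms by (intro of_nat_floor) simp
    finally have "real i \<le> u" .
    then show "i \<in> ?L"
      using k Y south_west_sample_at[of i ?Y c] by (simp add: sample_config_def quadrant_def del: south_bold.simps)
  qed
  then have "height_function u y (sample_config c) = card ({..<nat \<lfloor>u\<rfloor>} \<inter> {i. sver (Suc i) (?Y - 1) c})"
    unfolding height_function_def by (simp only: card_image inj_Suc inj_on_subset[OF inj_Suc subset_UNIV])
  then show ?thesis by (simp add: vsum_def sum_of_bool_eq)
qed

lemma (in step_box) six_vertex_measure_eq: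
  assumes "u > 0" "y > 0" "nat \<lfloor>u\<rfloor> \<le> N" "nat \<lceil>y\<rceil> - 1 \<le> M"
  shows "measure (six_vertex_measure b1 b2)
      {\<omega> \<in> space (six_vertex_measure b1 b2). B (real (height_function u y \<omega>))}
    = PrQ (\<lambda>c. B (vsum (nat \<lfloor>u\<rfloor>) 0 (nat \<lceil>y\<rceil> - 1) c))"
proof -
  let ?S = "{\<omega> \<in> space (six_vertex_measure b1 b2). B (real (height_function u y \<omega>))}"
  have "?S = height_function u y -` {k. B (real k)} \<inter> space (six_vertex_measure b1 b2)" by auto
  also have "\<dots> \<in> sets (six_vertex_measure b1 b2)"
    by (rule measurable_sets[OF measurable_height_function]) (use assms in auto)
  finally have S: "?S \<in> sets (six_vertex_measure b1 b2)" .
  have "measure (six_vertex_measure b1 b2) ?S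
      = measure (coins b1 b2) (sample_config -` ?S \<inter> space (coins b1 b2))"
    using S unfolding six_vertex_measure_def
    by (intro measure_distr measurable_sample_config) simp
  also have "sample_config -` ?S \<inter> space (coins b1 b2)
      = {c \<in> space (coins b1 b2). B (vsum (nat \<lfloor>u\<rfloor>) 0 (nat \<lceil>y\<rceil> - 1) c)}"
    using sample_config_in_configs assms
    by (auto simp: space_six_vertex_measure height_function_sample_config)
  also have "measure (coins b1 b2) \<dots> = PrQ (\<lambda>c. B (vsum (nat \<lfloor>u\<rfloor>) 0 (nat \<lceil>y\<rceil> - 1) c))"
  proof (rule measure_coins_eq)
    fix c c' :: "nat \<times> nat \<Rightarrow> bool \<times> bool"
    assume c: "\<And>z. z \<in> {1..N} \<times> {1..M} \<Longrightarrow> c z = c' z"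
    show "B (vsum (nat \<lfloor>u\<rfloor>) 0 (nat \<lceil>y\<rceil> - 1) c) = B (vsum (nat \<lfloor>u\<rfloor>) 0 (nat \<lceil>y\<rceil> - 1) c')"
      by (rule arg_cong[where f = B], rule vsum_cong[OF c]) (use assms in auto)
  qed
  finally show ?thesis .
qed


section \<open>Convergence\<close>

text \<open>First the grid size \<open>g\<close> is taken large, with \<open>d = 1 / g\<close>, to
  control the discretisation error; then the scale \<open>K\<close> is taken large to absorb
  everything that stays bounded. Each of the two errors gets half of \<open>K * eta\<close>.\<close>

lemma cell_bound:
  fixes x y H eta :: real
  assumes xy: "x > 0" "y > 0" and eta: "eta > 0" and H: "H \<ge> 0"
  obtains m n g K :: nat and d :: real where "m > 0" "n > 0" "g > 0" "K > 0" "d > 0"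
    "K * x \<le> m" "m \<le> K * (x + 1)" "n \<le> K * y" "m \<le> K * x + 1" "K * y - 1 \<le> n"
    "K * H + 2 + m / g + (real m + real n) * d + real m * real g * (1 / (m * d\<^sup>2) + 1 / (n * d\<^sup>2))
      \<le> K * (H + eta)"
proof -
  define C1 where "C1 = 2 * x + y + 2"
  obtain g :: nat where g: "g > 2 * C1 / eta" using reals_Archimedean2 by blast
  have "0 < 2 * C1 / eta" using xy eta by (simp add: C1_def)
  then have g0: "real g > 0" using g by linarith
  define C2 where "C2 = 2 + real g ^ 3 * (1 + 2 * (x + 1) / y)"
  obtain K :: nat where K: "K > max (max 1 (2 / y)) (2 * C2 / eta)" using reals_Archimedean2 by blast
  have K0: "real K > 1" "real K > 2 / y" "real K > 2 * C2 / eta" using K by auto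
  \<comment> \<open>Rounding \<open>m\<close> up and \<open>n\<close> down makes iterated steps go
    at least as far to the right and at most as far up as the ray through
    \<open>(x, y)\<close>.\<close>
  define m where "m = nat \<lceil>K * x\<rceil>"
  define n where "n = nat \<lfloor>K * y\<rfloor>"
  have Kx: "K * x > 0" "K * y \<ge> 2" using K0 xy by (simp_all add: pos_divide_less_eq less_imp_le)
  have m: "K * x \<le> m" "m \<le> K * x + 1" unfolding m_def using Kx by linarith+
  have n: "n \<le> K * y" "K * y - 1 \<le> n" unfolding n_def using Kx by linarith+
  have m': "m \<le> K * (x + 1)" using m K0 by (simp add: distrib_left)
  have n': "K * y / 2 \<le> n" using n Kx by linarith
  have pos: "real m > 0" "real n > 0" using m n n' Kx by linarith+
  have "real m / n \<le> (K * (x + 1)) / (K * y / 2)"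
    using m' n' pos Kx by (intro frac_le) auto
  also have "\<dots> = 2 * (x + 1) / y" using K0 by simp
  finally have mn: "real m / n \<le> 2 * (x + 1) / y" .
  \<comment> \<open>This term stays bounded as \<open>K\<close> grows because the ratio of
    \<open>m\<close> to \<open>n\<close> does, so \<open>K\<close> may be chosen after
    \<open>g\<close>.\<close>
  have "real m * real g * (1 / (m * (1 / real g)\<^sup>2) + 1 / (n * (1 / real g)\<^sup>2)) = real g ^ 3 * (1 + m / n)"
    using pos g0 by (simp add: power2_eq_square power3_eq_cube field_simps)
  also have "\<dots> \<le> C2 - 2"
    unfolding C2_def using mn g0 by (simp add: mult_left_mono)
  also have "C2 - 2 \<le> K * (eta / 2) - 2"
    using K0 eta by (simp add: pos_divide_less_eq)
  finally have 1: "2 + real m * real g * (1 / (m * (1 / real g)\<^sup>2) + 1 / (n * (1 / real g)\<^sup>2)) \<le> K * (eta / 2)"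
    by linarith
  have "m / g + (real m + real n) * (1 / g) = (2 * m + n) / real g"
    by (simp add: add_divide_distrib)
  also have "\<dots> \<le> K * C1 / g"
    using m' n g0 by (intro divide_right_mono) (auto simp: C1_def algebra_simps)
  also have "\<dots> = K * (C1 / g)" by simp
  also have "\<dots> \<le> K * (eta / 2)"
    using g g0 eta by (intro mult_left_mono) (simp_all add: field_simps)
  finally have 2: "m / g + (real m + real n) * (1 / g) \<le> K * (eta / 2)" .
  have "K * (H + eta) = K * H + K * (eta / 2) + K * (eta / 2)"
    by (simp add: algebra_simps)
  with 1 2 have cell: "K * H + 2 + m / g + (real m + real n) * (1 / g)
      + real m * real g * (1 / (m * (1 / real g)\<^sup>2) + 1 / (n * (1 / real g)\<^sup>2)) \<le> K * (H + eta)"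
    by linarith
  have "m > 0" "n > 0" "g > 0" "K > 0" "1 / real g > 0" using pos g0 K0 by simp_all
  from that[OF this m(1) m' n(1) m(2) n(2) cell] show thesis .
qed

text \<open>The cell is fixed first, and the averaging square has side about \<open>r * L\<close>.
  After about \<open>L / K\<close> steps the annihilation and shift errors are then bounded
  independently of \<open>L\<close>. The box side leaves room for the ray and the square.\<close>

lemma mean_height_upper:
  fixes b1 b2 x y eta :: real
  assumes b: "0 < b2" "b2 < b1" "b1 < 1" and xy: "x > 0" "y > 0" and eta: "eta > 0"
  defines "NN \<equiv> \<lambda>L. nat \<lceil>L * (x + y + 3)\<rceil>"
  shows "eventually (\<lambda>L. step_box.U b1 b2 (NN L) (NN L) (nat \<lfloor>L * x\<rfloor>) (nat \<lceil>L * y\<rceil> - 1)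
    \<le> L * (limit_height b1 b2 x y + eta)) at_top"
proof -
  define H where "H = limit_height b1 b2 x y"
  have Sup: "x * t - y * flux b1 b2 t \<le> H" if "0 \<le> t" "t \<le> 1" for t
    using limit_height_eq_Sup(1)[OF b(2,3) xy] that by (simp add: H_def)
  have H0: "H \<ge> 0" using Sup[of 0] by (simp add: flux_def)
  obtain m n g K :: nat and d :: real where mn: "m > 0" "n > 0" "g > 0" "K > 0" "d > 0"
    "K * x \<le> m" "m \<le> K * (x + 1)" "n \<le> K * y" "m \<le> K * x + 1" "K * y - 1 \<le> n"
    and cell: "K * H + 2 + m / g + (real m + real n) * d + real m * real g * (1 / (m * d\<^sup>2) + 1 / (n * d\<^sup>2))
      \<le> K * (H + eta / 2)"
    using cell_bound[OF xy half_gt_zero[OF eta] H0] .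
  \<comment> \<open>The summand 2 pays for rounding \<open>m\<close> and \<open>n\<close>, since
    \<open>t\<close> and \<open>flux b1 b2 t\<close> are at most 1.\<close>
  define V where "V = K * H + 2"
  have V: "m * t - n * flux b1 b2 t \<le> V" if t: "0 \<le> t" "t \<le> 1" for t :: real
  proof -
    note f = flux_bounds[OF b(2,3) t]
    have "m * t \<le> (K * x + 1) * t" using t mn by (intro mult_right_mono) auto
    also have "\<dots> \<le> K * (x * t) + 1" using t by (simp add: algebra_simps)
    finally have 1: "m * t \<le> K * (x * t) + 1" .
    have "(K * y - 1) * flux b1 b2 t \<le> n * flux b1 b2 t"
      using f mn by (intro mult_right_mono) auto
    then have 2: "n * flux b1 b2 t \<ge> K * (y * flux b1 b2 t) - 1" using f by (simp add: algebra_simps)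
    have "K * (x * t - y * flux b1 b2 t) \<le> K * H" using Sup[OF t] by (intro mult_left_mono) auto
    then show ?thesis using 1 2 by (simp add: V_def right_diff_distrib)
  qed
  define k0 where "k0 = min (b1 * b2) (b1 * (1 - b2))"
  have kappa: "k0 > 0" using b by (simp add: k0_def)
  \<comment> \<open>Small enough that the averaging cost \<open>2 * R\<close> takes only a fraction
    of \<open>L * eta\<close>.\<close>
  define r where "r = min (1 / 2) (eta / 16)"
  have r: "r > 0" "r \<le> 1 / 2" "r \<le> eta / 16" using eta by (auto simp: r_def)
  define c where "c = real m * real g * real m * real n / (2 * k0 ^ (m * n))"
  have c: "c \<ge> 0" using kappa by (simp add: c_def)
  \<comment> \<open>All errors bounded in \<open>L\<close>: the shift and annihilation terms, 2 for
    rounding \<open>R\<close>, and \<open>K * x + 1\<close> for the distance between the end of the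
    iteration and the target point.\<close>
  define C where "C = real m * real n / (K * r) + c * (2 * (x + y + 4)) / (K * r\<^sup>2) + 2 + K * x + 1"
  have "eventually (\<lambda>L::real. L \<ge> 2 \<and> L * y \<ge> 1 \<and> C \<le> L * (eta / 4)) at_top"
  proof (intro eventually_conj)
    show "eventually (\<lambda>L::real. L * y \<ge> 1) at_top"
      using eventually_ge_at_top[of "1 / y"] by eventually_elim (use xy in \<open>simp add: pos_divide_le_eq\<close>)
    show "eventually (\<lambda>L::real. C \<le> L * (eta / 4)) at_top"
      using eventually_ge_at_top[of "C / (eta / 4)"]
      by eventually_elim (use eta in \<open>simp add: pos_divide_le_eq\<close>)
  qed (rule eventually_ge_at_top)
  then show ?thesis
  proof eventually_elim
    case (elim L)
    have L: "L \<ge> 2" "L * y \<ge> 1" "C \<le> L * (eta / 4)" "L > 0" using elim by auto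
    define N where "N = NN L"
    interpret step_box b1 b2 N N by unfold_locales (use b in auto)
    have kappa_eq: "step_box.\<kappa> b1 b2 = k0"
      by (simp only: k0_def step_box.\<kappa>_def[OF step_box_axioms])
    define T where "T = nat \<lfloor>L / K\<rfloor>"
    define R where "R = nat \<lceil>r * L\<rceil>"
    have K: "real K > 0" using mn by simp
    have LK: "L / K > 0" using L K by simp
    have T: "T \<le> L / K" "L / K - 1 \<le> T" unfolding T_def using LK by linarith+
    have rL: "r * L > 0" using r L by simp
    have R: "r * L \<le> R" "R \<le> r * L + 1" unfolding R_def using rL by linarith+
    have R0: "real R > 0" using R rL by linarith
    have N: "L * (x + y + 3) \<le> N" "N \<le> L * (x + y + 3) + 1"
    proof -
      have "L * (x + y + 3) > 0" using L xy by simp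
      then show "L * (x + y + 3) \<le> N" "N \<le> L * (x + y + 3) + 1"
        unfolding N_def NN_def by linarith+
    qed
    have "r * L \<le> 1 / 2 * L" using r L by (intro mult_right_mono) auto
    then have RL: "R \<le> L" using R L by linarith
    have "real T * m \<le> L / K * (K * (x + 1))" using T mn LK by (intro mult_mono) auto
    then have Tm: "real T * m \<le> L * (x + 1)" using K by simp
    have "real T * n \<le> L / K * (K * y)" using T mn LK by (intro mult_mono) auto
    then have Tn: "real T * n \<le> L * y" using K by simp
    have Lxy: "L * x > 0" "L * y > 0" "L * (x + y + 3) = L * x + L * y + L * 3" "L * (x + 1) = L * x + L"
      using L xy by (simp_all add: algebra_simps)
    have "real (T * m + R) \<le> N" unfolding of_nat_add of_nat_mult using Tm RL N L Lxy by linarith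
    then have box1: "T * m + R \<le> N" by (simp only: of_nat_le_iff)
    have "real (T * n + R) \<le> N" unfolding of_nat_add of_nat_mult using Tn RL N L Lxy by linarith
    then have box2: "T * n + R \<le> N" by (simp only: of_nat_le_iff)
    define A where "A = V + m / g + (real m + real n) * d + real m * real g * (1 / (m * d\<^sup>2) + 1 / (n * d\<^sup>2))"
    have A: "A \<le> K * (H + eta / 2)" using cell by (simp add: A_def V_def)
    have "U (T * m) (T * n) \<le> 2 * real R + T * (V + m / g + (real m + real n) * d
        + real m * real g * (1 / (m * d\<^sup>2) + 1 / (n * d\<^sup>2))
        + real m * real g * real m * real n * (real N + real N) / (2 * step_box.\<kappa> b1 b2 ^ (m * n) * (real R)\<^sup>2)
        + real m * real n / R)"
      by (rule mean_height_le[OF V mn(3) mn(5) box1 box2 mn(1,2)]) (use R0 in auto)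
    then have U1: "U (T * m) (T * n) \<le> 2 * real R + T * A + T * (c * (2 * real N) / (real R)\<^sup>2)
        + T * (real m * real n / R)"
      unfolding kappa_eq by (simp add: A_def c_def distrib_left)
    have "T * A \<le> T * (K * (H + eta / 2))" using A by (intro mult_left_mono) auto
    also have "\<dots> \<le> L / K * (K * (H + eta / 2))"
      using T H0 eta by (intro mult_right_mono) auto
    finally have TA: "T * A \<le> L * (H + eta / 2)" using K by simp
    have "T * (real m * real n / R) \<le> L / K * (real m * real n / (r * L))"
      using T R R0 r L LK by (intro mult_mono divide_left_mono mult_pos_pos) auto
    also have "\<dots> = real m * real n / (K * r)" using L by simp
    finally have T1: "T * (real m * real n / R) \<le> real m * real n / (K * r)" .
    have "2 * real N \<le> L * (2 * (x + y + 4))" using N L by (simp add: algebra_simps)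
    then have "c * (2 * real N) \<le> c * (L * (2 * (x + y + 4)))" using c by (rule mult_left_mono)
    moreover have "0 \<le> c * (L * (2 * (x + y + 4)))" using c L xy by simp
    moreover have "(r * L)\<^sup>2 \<le> (real R)\<^sup>2" "0 < (r * L)\<^sup>2" using R r L by (simp_all add: power_mono)
    ultimately have "c * (2 * real N) / (real R)\<^sup>2 \<le> c * (L * (2 * (x + y + 4))) / (r * L)\<^sup>2"
      by (intro frac_le)
    then have "T * (c * (2 * real N) / (real R)\<^sup>2) \<le> L / K * (c * (L * (2 * (x + y + 4))) / (r * L)\<^sup>2)"
      using T LK c by (intro mult_mono) auto
    also have "\<dots> = c * (2 * (x + y + 4)) / (K * r\<^sup>2)"
      using L by (simp add: power2_eq_square)
    finally have T2: "T * (c * (2 * real N) / (real R)\<^sup>2) \<le> c * (2 * (x + y + 4)) / (K * r\<^sup>2)" .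
    define X where "X = nat \<lfloor>L * x\<rfloor>"
    define Y where "Y = nat \<lceil>L * y\<rceil> - 1"
    have "(L / K - 1) * (K * x) \<le> T * real m" using T mn LK xy by (intro mult_mono) auto
    then have "L * x - K * x \<le> T * m" using K by (simp add: left_diff_distrib)
    moreover have "X \<le> L * x" using L xy by (simp add: X_def)
    moreover have "K * x \<ge> 0" using xy by simp
    ultimately have X: "real (X - T * m) \<le> K * x" by (simp add: of_nat_diff_if)
    have "real Y \<ge> L * y - 1"
    proof -
      have "nat \<lceil>L * y\<rceil> \<ge> 1" using L by linarith
      then have "real Y = real (nat \<lceil>L * y\<rceil>) - 1" by (simp add: Y_def of_nat_diff)
      then show ?thesis using real_nat_ceiling_ge[of "L * y"] by linarith
    qed
    then have Y: "real (T * n - Y) \<le> 1" using Tn by (simp add: of_nat_diff_if)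
    have "U X Y \<le> U (T * m) (T * n) + real (X - T * m) + real (T * n - Y)" by (rule U_le_U)
    then have "U X Y \<le> 2 * real R + L * (H + eta / 2) + c * (2 * (x + y + 4)) / (K * r\<^sup>2)
        + real m * real n / (K * r) + K * x + 1"
      using U1 TA T1 T2 X Y by linarith
    then have "U X Y \<le> 2 * (r * L) + L * (H + eta / 2) + C"
      using R unfolding C_def by linarith
    moreover have "r * L \<le> eta / 16 * L" using r L by (intro mult_right_mono) auto
    moreover have "L * (H + eta) = 8 * (eta / 16 * L) + L * (H + eta / 2)" "L * (eta / 4) = 4 * (eta / 16 * L)"
      "eta / 16 * L \<ge> 0"
      using L eta by (simp_all add: algebra_simps)
    ultimately have "U X Y \<le> L * (H + eta)" using L(3) by linarith
    then show ?case by (simp add: H_def X_def Y_def N_def)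
  qed
qed

section \<open>The lower tail and the deviation probability\<close>

lemma filterlim_nat_floor_mult: "x > 0 \<Longrightarrow> filterlim (\<lambda>L::real. real (nat \<lfloor>L * x\<rfloor>)) at_top at_top"
  and filterlim_nat_ceiling_mult: "x > 0 \<Longrightarrow> filterlim (\<lambda>L::real. real (nat \<lceil>L * x\<rceil> - 1)) at_top at_top"
proof -
  assume x: "x > 0"
  have lin: "filterlim (\<lambda>L::real. - 1 + L * x) at_top at_top"
    using x by (intro filterlim_tendsto_add_at_top[OF tendsto_const] filterlim_at_top_mult_tendsto_pos[OF tendsto_const] filterlim_ident)
  show "filterlim (\<lambda>L::real. real (nat \<lfloor>L * x\<rfloor>)) at_top at_top"
    by (rule filterlim_at_top_mono[OF lin]) (auto intro!: always_eventually; linarith)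
  show "filterlim (\<lambda>L::real. real (nat \<lceil>L * x\<rceil> - 1)) at_top at_top"
    by (rule filterlim_at_top_mono[OF lin]) (auto intro!: always_eventually; linarith)
qed

text \<open>The lower tail bound is applied with a density \<open>t\<close> at which the supremum
  defining the limit shape is attained.\<close>

lemma lower_tail_tendsto:
  fixes b1 b2 x y eta :: real
  assumes b: "0 < b2" "b2 < b1" "b1 < 1" and xy: "x > 0" "y > 0" and eta: "eta > 0"
  defines "NN \<equiv> \<lambda>L. nat \<lceil>L * (x + y + 3)\<rceil>"
  shows "((\<lambda>L. measure_pmf.prob (step_box.Q b1 b2 (NN L) (NN L))
      {c. vsum (nat \<lfloor>L * x\<rfloor>) 0 (nat \<lceil>L * y\<rceil> - 1) c < L * (limit_height b1 b2 x y - eta)}) \<longlongrightarrow> 0) at_top"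
proof -
  define H where "H = limit_height b1 b2 x y"
  obtain t where t: "0 \<le> t" "t \<le> 1" "x * t - y * flux b1 b2 t = H"
    using limit_height_eq_Sup(2)[OF b(2,3) xy] by (auto simp: H_def)
  note f = flux_bounds[OF b(2,3) t(1,2)]
  \<comment> \<open>The fluctuations allowed at the bottom and on the right then add up to at most
    \<open>L * (eta / 2)\<close>.\<close>
  define d where "d = eta / (2 * (x + y))"
  have "eta / (2 * a) * a = eta / 2" if "a > 0" for a using that by simp
  from this[of "x + y"] have d: "d > 0" "d * (x + y) = eta / 2" unfolding d_def using xy eta by simp_all
  let ?X = "\<lambda>L. nat \<lfloor>L * x\<rfloor>" and ?Y = "\<lambda>L. nat \<lceil>L * y\<rceil> - 1"
  let ?u = "\<lambda>L. 1 / (?X L * d\<^sup>2) + 1 / (?Y L * d\<^sup>2)"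
  have X: "filterlim (\<lambda>L. real (?X L)) at_top at_top" and Y: "filterlim (\<lambda>L. real (?Y L)) at_top at_top"
    using filterlim_nat_floor_mult filterlim_nat_ceiling_mult xy by auto
  have "(?u \<longlongrightarrow> 0 + 0) at_top"
    using d X Y
    by (intro tendsto_add tendsto_divide_0[OF tendsto_const] filterlim_at_top_imp_at_infinity
        filterlim_at_top_mult_tendsto_pos[OF tendsto_const]) auto
  then have u: "(?u \<longlongrightarrow> 0) at_top" by simp
  have "eventually (\<lambda>L. measure_pmf.prob (step_box.Q b1 b2 (NN L) (NN L))
      {c. vsum (?X L) 0 (?Y L) c < L * (H - eta)} \<le> ?u L) at_top"
    using filterlim_at_top_dense[THEN iffD1, OF X, rule_format, of 0]
      filterlim_at_top_dense[THEN iffD1, OF Y, rule_format, of 0]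
      eventually_ge_at_top[of "1 :: real"] eventually_ge_at_top[of "2 / eta"]
  proof eventually_elim
    case (elim L)
    have L: "L > 0" using elim by simp
    interpret step_box b1 b2 "NN L" "NN L" by unfold_locales (use b in auto)
    have Lxy: "L * x > 0" "L * y > 0" using L xy by auto
    have Xb: "?X L \<le> L * x" "L * x - 1 \<le> ?X L" using Lxy by linarith+
    have Yb: "?Y L \<le> L * y" using Lxy by linarith
    have N: "L * (x + y + 3) \<le> NN L" unfolding NN_def by linarith
    have "L * (x + y + 3) = L * x + L * y + L * 3" by (simp add: algebra_simps)
    then have "?X L \<le> NN L" "?Y L \<le> NN L" using Xb Yb N L Lxy by linarith+
    moreover have "?X L > 0" "?Y L > 0" using elim by auto
    ultimately have tail: "PrQ (\<lambda>c. vsum (?X L) 0 (?Y L) c < ?X L * (t - d) - ?Y L * (flux b1 b2 t + d)) \<le> ?u L"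
      by (intro PrQ_lower_tail t d)
    have "?X L * t \<ge> (L * x - 1) * t" using Xb t by (intro mult_right_mono) auto
    then have 1: "?X L * t \<ge> L * (x * t) - 1" using t by (simp add: algebra_simps)
    have 2: "?Y L * flux b1 b2 t \<le> L * (y * flux b1 b2 t)"
      using mult_right_mono[OF Yb f(1)] by (simp add: mult.assoc)
    have "?X L * d + ?Y L * d \<le> L * x * d + L * y * d"
      using Xb Yb d by (intro add_mono mult_right_mono) auto
    also have "\<dots> = L * (d * (x + y))" by (simp add: algebra_simps)
    finally have 3: "?X L * d + ?Y L * d \<le> L * (eta / 2)" unfolding d(2) .
    \<comment> \<open>The other half of the allowance pays for rounding \<open>L * x\<close> down,
      which costs at most 1.\<close>
    have "1 \<le> L * (eta / 2)" using elim eta by (simp add: pos_divide_le_eq)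
    moreover have "L * (H - eta) = L * (x * t) - L * (y * flux b1 b2 t) - L * (eta / 2) - L * (eta / 2)"
      unfolding t(3)[symmetric] by (simp add: algebra_simps)
    ultimately have "L * (H - eta) \<le> ?X L * (t - d) - ?Y L * (flux b1 b2 t + d)"
      using 1 2 3 unfolding right_diff_distrib distrib_left by linarith
    then have "PrQ (\<lambda>c. vsum (?X L) 0 (?Y L) c < L * (H - eta))
        \<le> PrQ (\<lambda>c. vsum (?X L) 0 (?Y L) c < ?X L * (t - d) - ?Y L * (flux b1 b2 t + d))"
      by (intro measure_pmf.finite_measure_mono) auto
    with tail show ?case by linarith
  qed
  then show ?thesis
    unfolding H_def
    by (intro tendsto_sandwich[OF _ _ tendsto_const u]) (auto intro!: always_eventually)
qed

text \<open>Markov's inequality for the excess over \<open>H - eta\<close>, which has mean at most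
  \<open>2 * eta\<close> and is negative only on the lower tail. There it is compensated by a
  multiple of the tail probability, as the height is nonnegative.\<close>

lemma (in step_box) PrQ_deviation_le:
  assumes L: "L > 0" and H: "H \<ge> 0" and e: "e > 0" and eta: "0 < eta" "eta \<le> e"
    and up: "U X Y \<le> L * (H + eta)"
  shows "PrQ (\<lambda>c. \<bar>vsum X 0 Y c / L - H\<bar> > e)
    \<le> 2 * eta / e + (H / e + 1) * PrQ (\<lambda>c. vsum X 0 Y c < L * (H - eta))"
proof -
  let ?lo = "\<lambda>c. ind (vsum X 0 Y c < L * (H - eta))"
  have pw: "ind (\<bar>vsum X 0 Y c / L - H\<bar> > e) \<le> (vsum X 0 Y c / L - H + eta) / e + (H / e + 1) * ?lo c" for c
  proof -
    define z where "z = vsum X 0 Y c / L"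
    have z0: "z \<ge> 0" using L vsum_nonneg by (simp add: z_def)
    have lo: "vsum X 0 Y c < L * (H - eta) \<longleftrightarrow> z < H - eta"
      using L by (simp add: z_def pos_divide_less_eq mult.commute)
    \<comment> \<open>An upper deviation makes the first bracket exceed \<open>e\<close>; a lower
      one lies in the tail event because \<open>eta \<le> e\<close>.\<close>
    have "e * ind (\<bar>z - H\<bar> > e) \<le> (z - H + eta) + (H + e) * ind (z < H - eta)"
      using z0 e eta H by (auto simp: abs_if split: if_splits)
    then have "ind (\<bar>z - H\<bar> > e) \<le> ((z - H + eta) + (H + e) * ind (z < H - eta)) / e"
      using e by (simp add: pos_le_divide_eq mult.commute)
    also have "\<dots> = (z - H + eta) / e + (H / e + 1) * ind (z < H - eta)"
      using e by (simp add: field_simps)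
    finally show ?thesis unfolding lo by (simp add: z_def)
  qed
  have "PrQ (\<lambda>c. \<bar>vsum X 0 Y c / L - H\<bar> > e)
      \<le> EQ (\<lambda>c. (vsum X 0 Y c / L - H + eta) / e + (H / e + 1) * ?lo c)"
    unfolding PrQ_eq_EQ by (intro integral_mono integrable_Q pw)
  also have "\<dots> = (U X Y / L - H + eta) / e + (H / e + 1) * PrQ (\<lambda>c. vsum X 0 Y c < L * (H - eta))"
    unfolding PrQ_eq_EQ U_def by simp
  finally have main: "PrQ (\<lambda>c. \<bar>vsum X 0 Y c / L - H\<bar> > e)
      \<le> (U X Y / L - H + eta) / e + (H / e + 1) * PrQ (\<lambda>c. vsum X 0 Y c < L * (H - eta))" .
  have "U X Y / L \<le> H + eta" using up L by (simp add: pos_divide_le_eq mult.commute)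
  then have "(U X Y / L - H + eta) / e \<le> 2 * eta / e"
    using e by (intro divide_right_mono) auto
  with main show ?thesis by linarith
qed

theorem theorem1p1:
  fixes b1 b2 x y :: real
  assumes "0 < b2" and "b2 < b1" and "b1 < 1"
    and "x > 0" and "y > 0"
  shows "\<forall>\<epsilon>>0. ((\<lambda>L::real.
    measure (six_vertex_measure b1 b2)
      {\<omega> \<in> space (six_vertex_measure b1 b2).
         \<bar>real (height_function (L * x) (L * y) \<omega>) / L - limit_height b1 b2 x y\<bar> > \<epsilon>})
    \<longlongrightarrow> 0) at_top"
proof (intro allI impI)
  fix e :: real assume e: "e > 0"
  define H where "H = limit_height b1 b2 x y"
  have "0 * x - y * flux b1 b2 0 \<le> H"
    using bspec[OF limit_height_eq_Sup(1)[OF assms(2-5)], of 0] by (simp add: H_def)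
  then have H0: "H \<ge> 0" by (simp add: flux_def)
  define NN where "NN L = nat \<lceil>L * (x + y + 3)\<rceil>" for L
  let ?X = "\<lambda>L. nat \<lfloor>L * x\<rfloor>" and ?Y = "\<lambda>L. nat \<lceil>L * y\<rceil> - 1"
  let ?m = "\<lambda>L. measure (six_vertex_measure b1 b2) {\<omega> \<in> space (six_vertex_measure b1 b2).
         \<bar>real (height_function (L * x) (L * y) \<omega>) / L - H\<bar> > e}"
  have "(?m \<longlongrightarrow> 0) at_top"
  proof (rule tendstoI)
    fix \<delta> :: real assume \<delta>: "\<delta> > 0"
    \<comment> \<open>Chosen so that the Markov term \<open>2 * eta / e\<close> is at most half of
      \<open>\<delta>\<close>; \<open>\<rho>\<close> below is the tail probability that accounts for
      the other half.\<close>
    define eta where "eta = min e (e * \<delta> / 4)"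
    have eta: "eta > 0" "eta \<le> e" "2 * eta / e \<le> \<delta> / 2"
      using e \<delta> by (auto simp: eta_def min_def field_simps)
    define \<rho> where "\<rho> = \<delta> / (2 * (H / e + 1))"
    have He: "H / e + 1 > 0" using H0 e by (simp add: add_nonneg_pos)
    have "a * (\<delta> / (2 * a)) = \<delta> / 2" if "a > 0" for a using that by simp
    from this[OF He] have rho: "(H / e + 1) * \<rho> = \<delta> / 2" "\<rho> > 0"
      unfolding \<rho>_def using He \<delta> by simp_all
    have low: "eventually (\<lambda>L. measure_pmf.prob (step_box.Q b1 b2 (NN L) (NN L))
        {c. vsum (?X L) 0 (?Y L) c < L * (H - eta)} < \<rho>) at_top"
      unfolding H_def NN_def
      using order_tendstoD(2)[OF lower_tail_tendsto[OF assms eta(1)] rho(2)] .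
    have up: "eventually (\<lambda>L. step_box.U b1 b2 (NN L) (NN L) (?X L) (?Y L) \<le> L * (H + eta)) at_top"
      unfolding H_def NN_def by (rule mean_height_upper[OF assms eta(1)])
    show "eventually (\<lambda>L. dist (?m L) 0 < \<delta>) at_top"
      using low up eventually_gt_at_top[of 0]
    proof eventually_elim
      case (elim L)
      interpret step_box b1 b2 "NN L" "NN L" by unfold_locales (use assms in auto)
      have L: "L > 0" by (rule elim)
      have Lxy: "L * x > 0" "L * y > 0" using L assms by auto
      have N: "L * (x + y + 3) \<le> NN L" unfolding NN_def by linarith
      have "L * (x + y + 3) = L * x + L * y + L * 3" by (simp add: algebra_simps)
      then have le: "?X L \<le> NN L" "?Y L \<le> NN L" using N L Lxy by linarith+
      have "?m L = PrQ (\<lambda>c. \<bar>vsum (?X L) 0 (?Y L) c / L - H\<bar> > e)"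
        using six_vertex_measure_eq[OF Lxy le, of "\<lambda>k. \<bar>k / L - H\<bar> > e"] .
      also have "\<dots> \<le> 2 * eta / e + (H / e + 1) * PrQ (\<lambda>c. vsum (?X L) 0 (?Y L) c < L * (H - eta))"
        by (rule PrQ_deviation_le[OF L H0 e eta(1,2) elim(2)])
      also have "\<dots> < \<delta> / 2 + (H / e + 1) * \<rho>"
        using eta(3) elim(1) He by (intro add_le_less_mono mult_strict_left_mono)
      finally show ?case using rho(1) by simp
    qed
  qed
  then show "((\<lambda>L. measure (six_vertex_measure b1 b2) {\<omega> \<in> space (six_vertex_measure b1 b2).
      e < \<bar>real (height_function (L * x) (L * y) \<omega>) / L - limit_height b1 b2 x y\<bar>}) \<longlongrightarrow> 0) at_top"
    by (simp only: H_def)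
qed

end
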